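(* Let $D$ be a Dedekind domain (not a field) with finite residue fields, let $K$ be the field of fractions of $D$, and let $n\ge 2$. Then $\mathrm{Int}_K(M_n(D))$ is not integrally closed.
   Context: $\mathrm{Int}_K(M_n(D))=\{f\in K[x]\mid f(M_n(D))\subseteq M_n(D)\}$, with evaluation in $M_n(K)$. "Integrally closed" means integrally closed in its fraction field $K(x)$. *)

theory Defs
  imports
    "HOL-Algebra.Algebraic_Closure_Type"
    "HOL-Algebra.QuotRing"
    "HOL-Algebra.Ring_Divisibility"
    "HOL-Computational_Algebra.Polynomial_Factorial"
    "Jordan_Normal_Form.Matrix"
begin

text \<open>
  Integral domains are subrings \<open>S\<close> of an ambient field, the field being a type of class
  \<^class>\<open>field\<close>; \<open>subring_of S\<close> is \<open>S\<close> with the operations of that field. It is a ring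
  only if \<open>S\<close> is closed under them.
\<close>

abbreviation subring_of :: "'k::field set \<Rightarrow> 'k ring" where
  "subring_of S \<equiv> ring_of_type_algebra\<lparr>carrier := S\<rparr>"

definition fraction_field :: "'k::field set \<Rightarrow> 'k set" where
  "fraction_field S = {a / b | a b. a \<in> S \<and> b \<in> S \<and> b \<noteq> 0}"

definition integral_over :: "'k::field set \<Rightarrow> 'k \<Rightarrow> bool" where
  "integral_over S x \<longleftrightarrow>
     (\<exists>p. lead_coeff p = 1 \<and> (\<forall>i. coeff p i \<in> S) \<and> poly p x = 0)"

definition integrally_closed :: "'k::field set \<Rightarrow> bool" where
  "integrally_closed S \<longleftrightarrow> (\<forall>x \<in> fraction_field S. integral_over S x \<longrightarrow> x \<in> S)"

text \<open>Fields count as Dedekind domains here.\<close>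

definition dedekind_domain :: "'k::field set \<Rightarrow> bool" where
  "dedekind_domain D \<longleftrightarrow>
     noetherian_domain (subring_of D) \<and>
     integrally_closed D \<and>
     (\<forall>P. primeideal P (subring_of D) \<longrightarrow> P \<noteq> {0} \<longrightarrow> maximalideal P (subring_of D))"

definition finite_residue_fields :: "'k::field set \<Rightarrow> bool" where
  "finite_residue_fields D \<longleftrightarrow>
     (\<forall>P. maximalideal P (subring_of D) \<longrightarrow> finite (carrier (subring_of D Quot P)))"

definition matrices_over :: "nat \<Rightarrow> 'k::field set \<Rightarrow> 'k mat set" where
  "matrices_over n D = {A \<in> carrier_mat n n. elements_mat A \<subseteq> D}"

definition poly_mat :: "nat \<Rightarrow> 'k::field poly \<Rightarrow> 'k mat \<Rightarrow> 'k mat" where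
  "poly_mat n f A =
     (\<Oplus>\<^bsub>ring_mat TYPE('k) n ()\<^esub> i \<in> {..degree f}. coeff f i \<cdot>\<^sub>m (A ^\<^sub>m i))"

definition Int_matrices :: "nat \<Rightarrow> 'k::field set \<Rightarrow> 'k poly set" where
  "Int_matrices n D = {f. \<forall>A \<in> matrices_over n D. poly_mat n f A \<in> matrices_over n D}"

text \<open>
  The fraction field of \<open>Int_matrices n D\<close>, formed inside \<open>'k poly fract\<close>, is all of the
  rational function field.
\<close>

context
  fixes D :: "'k::field set"
  assumes D: "domain (subring_of D)"
begin

interpretation D: domain "subring_of D" by (fact D)

lemma subring_closed:
  shows "0 \<in> D" "1 \<in> D" "\<And>a b. a \<in> D \<Longrightarrow> b \<in> D \<Longrightarrow> a + b \<in> D"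
    "\<And>a b. a \<in> D \<Longrightarrow> b \<in> D \<Longrightarrow> a * b \<in> D"
  using D.zero_closed D.one_closed D.a_closed D.m_closed
  by (simp_all add: ring_of_type_algebra_def)

lemma common_denominator:
  assumes "fraction_field D = UNIV"
  shows "\<exists>d \<in> D - {0}. \<forall>i. d * coeff f i \<in> D"
proof (induction f)
  case 0
  then show ?case using subring_closed by (intro bexI[of _ 1]) auto
next
  case (pCons c f)
  then obtain d where d: "d \<in> D" "d \<noteq> 0" "\<And>i. d * coeff f i \<in> D" by auto
  obtain a b where ab: "c = a / b" "a \<in> D" "b \<in> D" "b \<noteq> 0"
    using assms unfolding fraction_field_def by (smt (verit) UNIV_I mem_Collect_eq)
  have "d * b * coeff (pCons c f) i \<in> D" for i
  proof (cases i)
    case 0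
    then show ?thesis using d ab subring_closed(4)[of d a] by simp
  next
    case (Suc j)
    then show ?thesis using subring_closed(4)[OF ab(3) d(3)[of j]] by (simp add: mult_ac)
  qed
  then show ?case using d ab subring_closed by (intro bexI[of _ "d * b"]) auto
qed

lemma matrices_over_iff:
  "A \<in> matrices_over n D \<longleftrightarrow> A \<in> carrier_mat n n \<and> (\<forall>i<n. \<forall>j<n. A $$ (i, j) \<in> D)"
  unfolding matrices_over_def by (auto dest: elements_matD)

lemma sum_in_subring: "(\<And>i. i \<in> I \<Longrightarrow> g i \<in> D) \<Longrightarrow> sum g I \<in> D"
  by (induction I rule: infinite_finite_induct) (auto simp: subring_closed)

lemma matrices_over_mult:
  assumes "A \<in> matrices_over n D" "B \<in> matrices_over n D"
  shows "A * B \<in> matrices_over n D"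
  using assms unfolding matrices_over_iff
  by (auto simp: scalar_prod_def intro!: sum_in_subring subring_closed)

lemma matrices_over_pow:
  assumes "A \<in> matrices_over n D"
  shows "A ^\<^sub>m k \<in> matrices_over n D"
proof (induction k)
  case 0
  have "dim_row A = n" using assms by (auto simp: matrices_over_iff)
  then show ?case by (auto simp: matrices_over_iff subring_closed)
next
  case (Suc k)
  then show ?case using matrices_over_mult[OF _ assms] by simp
qed

lemma poly_mat_in_matrices_over:
  assumes "\<And>i. coeff f i \<in> D" "A \<in> matrices_over n D"
  shows "poly_mat n f A \<in> matrices_over n D"
proof -
  interpret M: ring "ring_mat TYPE('k) n ()" by (rule ring_mat)
  let ?g = "\<lambda>i. coeff f i \<cdot>\<^sub>m (A ^\<^sub>m i)"
  have g: "?g i \<in> matrices_over n D" for i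
    using assms(1)[of i] matrices_over_pow[OF assms(2), of i]
    unfolding matrices_over_iff by (metis carrier_matD index_smult_mat(1) smult_carrier_mat subring_closed(4))
  have "finite I \<Longrightarrow> finsum (ring_mat TYPE('k) n ()) ?g I \<in> matrices_over n D" for I
  proof (induction I rule: finite_induct)
    case empty
    then show ?case by (auto simp: ring_mat_simps matrices_over_iff subring_closed)
  next
    case (insert x F)
    have "?g i \<in> carrier (ring_mat TYPE('k) n ())" for i
      using g[of i] by (simp add: ring_mat_simps matrices_over_iff)
    then have "finsum (ring_mat TYPE('k) n ()) ?g (insert x F)
        = ?g x \<oplus>\<^bsub>ring_mat TYPE('k) n ()\<^esub> finsum (ring_mat TYPE('k) n ()) ?g F"
      using insert.hyps by (intro M.finsum_insert) auto
    then have "finsum (ring_mat TYPE('k) n ()) ?g (insert x F)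
        = ?g x + finsum (ring_mat TYPE('k) n ()) ?g F"
      by (simp only: ring_mat_simps)
    then show ?case using insert.IH g[of x]
      by (auto simp: matrices_over_iff subring_closed)
  qed
  then show ?thesis unfolding poly_mat_def by blast
qed

lemma fraction_field_Int_matrices:
  assumes "fraction_field D = UNIV"
  shows "fraction_field (to_fract ` Int_matrices n D) = UNIV"
proof -
  have sub: "f \<in> Int_matrices n D" if "\<And>i. coeff f i \<in> D" for f
    using poly_mat_in_matrices_over[OF that] by (auto simp: Int_matrices_def)
  have "x \<in> fraction_field (to_fract ` Int_matrices n D)" for x :: "'k poly fract"
  proof -
    obtain f g where fg: "x = to_fract f / to_fract g" "g \<noteq> 0"
      by (cases x) (auto simp: Fract_conv_to_fract)
    obtain c where c: "c \<in> D" "c \<noteq> 0" "\<And>i. c * coeff f i \<in> D"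
      using common_denominator[OF assms, of f] by auto
    obtain d where d: "d \<in> D" "d \<noteq> 0" "\<And>i. d * coeff g i \<in> D"
      using common_denominator[OF assms, of g] by auto
    have "smult (c * d) f \<in> Int_matrices n D"
      using subring_closed(4)[OF d(1) c(3)] by (intro sub) (simp add: mult_ac)
    moreover have "smult (c * d) g \<in> Int_matrices n D"
      using subring_closed(4)[OF c(1) d(3)] by (intro sub) (simp add: mult_ac)
    moreover have "x = to_fract (smult (c * d) f) / to_fract (smult (c * d) g)"
    proof -
      have "smult (c * d) h = [:c * d:] * h" for h :: "'k poly" by simp
      then show ?thesis using fg c d by (simp only: to_fract_mult) simp
    qed
    moreover have "to_fract (smult (c * d) g) \<noteq> 0" using fg c d by simp
    ultimately show ?thesis unfolding fraction_field_def by blast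
  qed
  then show ?thesis by blast
qed

end

end

theory Submission
  imports Defs
    "HOL-Computational_Algebra.Group_Closure"
    "Jordan_Normal_Form.Jordan_Normal_Form"
begin

text \<open>
  Since \<open>D\<close> is Noetherian, the proper ideals \<open>{d \<in> D. y d \<in> D}\<close>, for \<open>y \<in> K - D\<close>, have a
  maximal member \<open>P = {d \<in> D. t d \<in> D}\<close>, and this ideal is prime. It is nonzero, hence maximal
  with finite residue field. The element \<open>t\<close> takes the place of the inverse of a uniformizer at
  \<open>P\<close>.

  Choose \<open>w \<in> D[X]\<close> with \<open>w(0) \<notin> P\<close> that modulo \<open>P\<close> is divisible by every polynomial of degree
  at most \<open>n\<close> whose constant term is not \<open>0\<close> (\<open>residue_cofactor\<close>), and let \<open>e > 0\<close> be an exponent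
  with \<open>d ^ e \<equiv> 1\<close> for all \<open>d \<in> D - P\<close>. The polynomial
  \[ f = t X^{n-1} w \cdot ((t X^n w)^e - 1) \]
  is integral over the ring of integer-valued polynomials but does not belong to it.

  It does not belong to it because the top right entry of \<open>f\<close> at the nilpotent Jordan block is the
  coefficient of \<open>X^{n-1}\<close> in \<open>f\<close>, namely \<open>- t w(0) \<notin> D\<close>.

  For the integrality, one monic polynomial \<open>\<phi>\<close> over \<open>D\<close> is exhibited such that \<open>\<phi>(f)\<close> lies in
  \<open>D[X] + \<chi> K[X]\<close> for every monic \<open>\<chi> \<in> D[X]\<close> of degree \<open>n\<close>. By the Cayley--Hamilton theorem
  \<open>\<phi>(f)\<close> is then integer-valued on matrices, and \<open>f\<close> is a root of the monic polynomial
  \<open>\<phi> - \<phi>(f)\<close>. There are three kinds of \<open>\<chi>\<close>.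

  \<^item> If \<open>\<chi>\<close> is not \<open>X^n\<close> modulo \<open>P\<close>, the choice of \<open>w\<close> puts already \<open>t X^{n-1} w\<close> into
    \<open>D[X] + \<chi> K[X]\<close>. Otherwise \<open>t X^n \<equiv> c + X s\<close> modulo \<open>\<chi>\<close>, with \<open>c \<in> D\<close> and \<open>s \<in> D[X]\<close>.

  \<^item> If \<open>c \<notin> P\<close> (an Eisenstein polynomial), then \<open>(t X^n w)^e - 1\<close> is an element of \<open>P\<close> plus a
    multiple of \<open>X\<close>. The former cancels the denominator of \<open>t X^{n-1} w\<close>, the latter turns it into
    \<open>t X^n w\<close>, and \<open>f\<close> lies in \<open>D[X] + \<chi> K[X]\<close>.

  \<^item> If \<open>c \<in> P\<close>, put \<open>b = t X^{n-1}\<close> and \<open>\<beta> = b - s\<close>. From \<open>X \<beta> \<equiv> c\<close> one gets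
    \<open>b \<beta>^{n-1} \<equiv> t c^{n-1} \<in> D\<close>, a monic equation for \<open>b\<close>, so \<open>f\<close> is integral although it may
    lie outside \<open>D[X] + \<chi> K[X]\<close>. Modulo the ideal generated by \<open>P\<close> and \<open>X\<close>, the element \<open>f\<close> is a
    constant multiple of \<open>b\<close>, so it satisfies there an equation
    \<open>f (f - \<sigma>)^{n-1} = \<tau>\<close> with \<open>\<sigma>\<close> and \<open>\<tau>\<close> among finitely many representatives. The product of
    these equations over all \<open>\<sigma>\<close> and \<open>\<tau>\<close> is independent of \<open>\<chi>\<close>, and a power of it
    cancels all denominators (\<open>degenerate_modulus\<close>).
\<close>

section \<open>Subrings and ideals\<close>

locale subring_set =
  fixes S :: "'a::comm_ring_1 set"
  assumes one_mem: "1 \<in> S"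
    and diff_mem: "a \<in> S \<Longrightarrow> b \<in> S \<Longrightarrow> a - b \<in> S"
    and mult_mem: "a \<in> S \<Longrightarrow> b \<in> S \<Longrightarrow> a * b \<in> S"
begin

lemma zero_mem: "0 \<in> S"
  using diff_mem[OF one_mem one_mem] by simp

lemma uminus_mem: "a \<in> S \<Longrightarrow> - a \<in> S"
  using diff_mem[OF zero_mem] by force

lemma add_mem: "a \<in> S \<Longrightarrow> b \<in> S \<Longrightarrow> a + b \<in> S"
  using diff_mem[OF _ uminus_mem] by force

lemma power_mem: "a \<in> S \<Longrightarrow> a ^ k \<in> S"
  by (induction k) (auto simp: one_mem mult_mem)

lemma sum_mem: "(\<And>i. i \<in> I \<Longrightarrow> g i \<in> S) \<Longrightarrow> sum g I \<in> S"
  by (induction I rule: infinite_finite_induct) (auto simp: zero_mem add_mem)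

lemma prod_mem: "(\<And>i. i \<in> I \<Longrightarrow> g i \<in> S) \<Longrightarrow> prod g I \<in> S"
  by (induction I rule: infinite_finite_induct) (auto simp: one_mem mult_mem)

end

definition polys_over :: "'a::comm_ring_1 set \<Rightarrow> 'a poly set" where
  "polys_over S = {f. \<forall>i. coeff f i \<in> S}"

lemma (in subring_set) pCons_mem_polys_over [simp]:
  "pCons a f \<in> polys_over S \<longleftrightarrow> a \<in> S \<and> f \<in> polys_over S"
  unfolding polys_over_def by (auto simp: coeff_pCons split: nat.splits)

lemma (in subring_set) zero_mem_polys_over [simp]: "0 \<in> polys_over S"
  unfolding polys_over_def by (auto simp: zero_mem)

lemma (in subring_set) subring_set_polys_over: "subring_set (polys_over S)"
  by unfold_locales
    (auto simp: polys_over_def coeff_mult one_mem zero_mem one_pCons coeff_pCons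
      intro!: diff_mem sum_mem mult_mem split: nat.splits)

locale ideal_set = subring_set S for S :: "'a::comm_ring_1 set" +
  fixes I :: "'a set"
  assumes subset: "I \<subseteq> S"
    and ideal_zero: "0 \<in> I"
    and ideal_diff: "a \<in> I \<Longrightarrow> b \<in> I \<Longrightarrow> a - b \<in> I"
    and ideal_mult: "a \<in> S \<Longrightarrow> b \<in> I \<Longrightarrow> a * b \<in> I"
begin

lemma ideal_uminus: "a \<in> I \<Longrightarrow> - a \<in> I"
  using ideal_diff[OF ideal_zero] by force

lemma ideal_add: "a \<in> I \<Longrightarrow> b \<in> I \<Longrightarrow> a + b \<in> I"
  using ideal_diff[OF _ ideal_uminus] by force

lemma ideal_mult_right: "a \<in> I \<Longrightarrow> b \<in> S \<Longrightarrow> a * b \<in> I"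
  using ideal_mult[of b a] by (simp add: mult.commute)

lemma ideal_sum: "(\<And>i. i \<in> K \<Longrightarrow> g i \<in> I) \<Longrightarrow> sum g K \<in> I"
  by (induction K rule: infinite_finite_induct) (auto simp: ideal_zero ideal_add)

lemma ideal_power: "a \<in> I \<Longrightarrow> k > 0 \<Longrightarrow> a ^ k \<in> I"
  using ideal_mult_right[OF _ power_mem] subset by (cases k) auto

lemma cong_trans: "a - b \<in> I \<Longrightarrow> b - c \<in> I \<Longrightarrow> a - c \<in> I"
  using ideal_add by fastforce

lemma cong_mem: "a - b \<in> I \<Longrightarrow> b \<in> I \<Longrightarrow> a \<in> I"
  using ideal_add by fastforce

lemma cong_mult:
  assumes "a - a' \<in> I" "b - b' \<in> I" "a \<in> S" "b' \<in> S"
  shows "a * b - a' * b' \<in> I"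
proof -
  have "a * b - a' * b' = a * (b - b') + b' * (a - a')" by (simp add: algebra_simps)
  then show ?thesis using assms ideal_mult ideal_add by metis
qed

lemma cong_power:
  assumes "a - b \<in> I" "a \<in> S" "b \<in> S"
  shows "a ^ k - b ^ k \<in> I"
  using assms by (induction k) (auto simp: ideal_zero intro: cong_mult power_mem)

lemma ideal_set_polys_over: "ideal_set (polys_over S) (polys_over I)"
proof -
  interpret X: subring_set "polys_over S" by (rule subring_set_polys_over)
  show ?thesis
    by unfold_locales
      (use subset in \<open>auto simp: polys_over_def coeff_mult ideal_zero
        intro!: ideal_diff ideal_sum ideal_mult\<close>)
qed

end

lemma dvd_diff_power:
  fixes a b d :: "'a::comm_ring_1"
  assumes "d dvd a - b"
  shows "d dvd a ^ k - b ^ k"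
proof (induction k)
  case (Suc k)
  have "a ^ Suc k - b ^ Suc k = a * (a ^ k - b ^ k) + b ^ k * (a - b)" by (simp add: algebra_simps)
  then show ?case using Suc assms by simp
qed simp

lemma group_closure_mult:
  fixes G H K :: "'a::comm_ring_1 set"
  assumes "\<And>g h. g \<in> G \<Longrightarrow> h \<in> H \<Longrightarrow> g * h \<in> group_closure K"
    and "a \<in> group_closure G" "b \<in> group_closure H"
  shows "a * b \<in> group_closure K"
  using assms(2)
proof induction
  case (base g)
  show ?case
    using assms(3)
  proof induction
    case (base h)
    then show ?case using assms(1) \<open>g \<in> insert 0 G\<close> by auto
  next
    case (diff b b')
    then show ?case by (simp add: right_diff_distrib group_closure.diff)
  qed
next
  case (diff a a')
  then show ?case by (simp add: left_diff_distrib group_closure.diff)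
qed

lemma group_closure_subset:
  assumes "G \<subseteq> V" "0 \<in> V" "\<And>a b. a \<in> V \<Longrightarrow> b \<in> V \<Longrightarrow> a - b \<in> V"
  shows "group_closure G \<subseteq> V"
proof
  fix x assume "x \<in> group_closure G"
  then show "x \<in> V" by induction (use assms in auto)
qed

context subring_set
begin

text \<open>The subring \<open>S[X] + \<chi> K[X]\<close>. The multiples of \<open>\<chi>\<close> are taken in the whole polynomial ring,
  because they vanish at every matrix with characteristic polynomial \<open>\<chi>\<close>.\<close>
definition polys_mod :: "'a poly \<Rightarrow> 'a poly set" where
  "polys_mod \<chi> = {h. \<exists>a \<in> polys_over S. \<chi> dvd h - a}"

lemma polys_over_subset_polys_mod: "polys_over S \<subseteq> polys_mod \<chi>"
  unfolding polys_mod_def by force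

lemma dvd_mem_polys_mod: "\<chi> dvd h \<Longrightarrow> h \<in> polys_mod \<chi>"
  unfolding polys_mod_def by (auto intro!: bexI[of _ 0])

lemma subring_set_polys_mod: "subring_set (polys_mod \<chi>)"
proof -
  interpret X: subring_set "polys_over S" by (rule subring_set_polys_over)
  show ?thesis
  proof
    show "1 \<in> polys_mod \<chi>" using X.one_mem polys_over_subset_polys_mod by blast
  next
    fix f g assume "f \<in> polys_mod \<chi>" "g \<in> polys_mod \<chi>"
    then obtain a b where ab: "a \<in> polys_over S" "\<chi> dvd f - a" "b \<in> polys_over S" "\<chi> dvd g - b"
      unfolding polys_mod_def by blast
    have "(f - g) - (a - b) = (f - a) - (g - b)" by simp
    then have "\<chi> dvd (f - g) - (a - b)" using ab by (simp only: dvd_diff)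
    then show "f - g \<in> polys_mod \<chi>" unfolding polys_mod_def using ab X.diff_mem by blast
    have "f * g - a * b = f * (g - b) + b * (f - a)" by (simp add: algebra_simps)
    then have "\<chi> dvd f * g - a * b" using ab by simp
    then show "f * g \<in> polys_mod \<chi>" unfolding polys_mod_def using ab X.mult_mem by blast
  qed
qed

end


lemma pcompose_mem_subring:
  fixes p q :: "'b::comm_ring_1 poly"
  assumes "subring_set T" and "\<And>i. [:coeff p i:] \<in> T" "q \<in> T"
  shows "pcompose p q \<in> T"
proof -
  interpret subring_set T by fact
  show ?thesis
    using assms(2)
  proof (induction p)
    case 0
    then show ?case by (simp add: zero_mem)
  next
    case (pCons a p)
    have "[:coeff p i:] \<in> T" for i using pCons.prems[of "Suc i"] by simp
    moreover have "[:a:] \<in> T" using pCons.prems[of 0] by simp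
    ultimately show ?case
      using pCons.IH assms(3) by (simp add: pcompose_pCons add_mem mult_mem)
  qed
qed

section \<open>Polynomials in a matrix\<close>

lemma (in subring_set) det_mem:
  assumes "A \<in> carrier_mat n n" "\<And>i j. i < n \<Longrightarrow> j < n \<Longrightarrow> A $$ (i, j) \<in> S"
  shows "det A \<in> S"
proof -
  have "signof p \<in> S" for p :: "nat \<Rightarrow> nat"
    by (cases p rule: sign_cases) (auto simp: one_mem uminus_mem)
  then show ?thesis
    using assms permutes_in_image
    by (fastforce simp: det_def' intro!: sum_mem mult_mem prod_mem)
qed

lemma (in subring_set) char_poly_mem_polys_over:
  assumes "A \<in> carrier_mat n n" "\<And>i j. i < n \<Longrightarrow> j < n \<Longrightarrow> A $$ (i, j) \<in> S"
  shows "char_poly A \<in> polys_over S"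
  unfolding char_poly_def
proof (rule subring_set.det_mem[OF subring_set_polys_over])
  show "char_poly_matrix A \<in> carrier_mat n n" using assms(1) by simp
  show "char_poly_matrix A $$ (i, j) \<in> polys_over S" if "i < n" "j < n" for i j
    using assms(1) assms(2)[OF that] that
    by (auto simp: char_poly_matrix_def zero_mem one_mem uminus_mem
        intro: subring_set.one_mem[OF subring_set_polys_over])
qed

text \<open>Evaluation at a matrix is handled entrywise: each entry is a linear functional on polynomials, and
  the ring structure of matrices is visible only through the product formula below.\<close>
definition poly_entry :: "'a::comm_ring_1 mat \<Rightarrow> 'a poly \<Rightarrow> nat \<Rightarrow> nat \<Rightarrow> 'a" where
  "poly_entry A f i j = (\<Sum>k\<le>degree f. coeff f k * (A ^\<^sub>m k) $$ (i, j))"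

lemma poly_mat_entry:
  fixes A :: "'k::field mat"
  assumes A: "A \<in> carrier_mat n n"
  shows "poly_mat n f A \<in> carrier_mat n n"
    and "\<lbrakk>i < n; j < n\<rbrakk> \<Longrightarrow> poly_mat n f A $$ (i, j) = poly_entry A f i j"
proof -
  interpret M: ring "ring_mat TYPE('k) n ()" by (rule ring_mat)
  let ?M = "ring_mat TYPE('k) n ()"
  let ?g = "\<lambda>k. coeff f k \<cdot>\<^sub>m (A ^\<^sub>m k)"
  have g: "?g k \<in> carrier_mat n n" for k using A by simp
  have "finsum ?M ?g I \<in> carrier_mat n n \<and>
      (\<forall>i<n. \<forall>j<n. finsum ?M ?g I $$ (i, j) = (\<Sum>k\<in>I. coeff f k * (A ^\<^sub>m k) $$ (i, j)))"
    if "finite I" for I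
    using that
  proof (induction I rule: finite_induct)
    case empty
    then show ?case by (simp add: ring_mat_simps)
  next
    case (insert x F)
    have "finsum ?M ?g (insert x F) = ?g x \<oplus>\<^bsub>?M\<^esub> finsum ?M ?g F"
      using insert.hyps g by (intro M.finsum_insert) (auto simp: ring_mat_simps)
    then have "finsum ?M ?g (insert x F) = ?g x + finsum ?M ?g F"
      by (simp only: ring_mat_simps)
    moreover have "A ^\<^sub>m x \<in> carrier_mat n n" using A by simp
    moreover have "dim_row A = n" "dim_col A = n" using A by auto
    ultimately show ?case using insert A by (auto simp: index_smult_mat)
  qed
  then show "poly_mat n f A \<in> carrier_mat n n"
    "\<lbrakk>i < n; j < n\<rbrakk> \<Longrightarrow> poly_mat n f A $$ (i, j) = poly_entry A f i j"
    unfolding poly_mat_def poly_entry_def by (meson finite_atMost)+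
qed

lemma poly_entry_eq_sum:
  assumes "degree f \<le> N"
  shows "poly_entry A f i j = (\<Sum>k\<le>N. coeff f k * (A ^\<^sub>m k) $$ (i, j))"
  unfolding poly_entry_def using assms
  by (intro sum.mono_neutral_left) (auto simp: coeff_eq_0)

lemma poly_entry_0 [simp]: "poly_entry A 0 i j = 0"
  by (simp add: poly_entry_def)

lemma poly_entry_add: "poly_entry A (f + g) i j = poly_entry A f i j + poly_entry A g i j"
proof -
  let ?N = "max (degree f) (degree g)"
  have "poly_entry A (f + g) i j = (\<Sum>k\<le>?N. coeff (f + g) k * (A ^\<^sub>m k) $$ (i, j))"
    by (rule poly_entry_eq_sum) (rule degree_add_le_max)
  then show ?thesis
    by (simp add: poly_entry_eq_sum[of f ?N] poly_entry_eq_sum[of g ?N] sum.distrib algebra_simps)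
qed

lemma poly_entry_smult: "poly_entry A (smult c f) i j = c * poly_entry A f i j"
proof -
  have "poly_entry A (smult c f) i j = (\<Sum>k\<le>degree f. coeff (smult c f) k * (A ^\<^sub>m k) $$ (i, j))"
    by (rule poly_entry_eq_sum) (rule degree_smult_le)
  then show ?thesis
    by (simp add: poly_entry_def sum_distrib_left mult.assoc)
qed

lemma poly_entry_pCons:
  assumes A: "A \<in> carrier_mat n n" and ij: "i < n" "j < n"
  shows "poly_entry A (pCons a f) i j
    = (if i = j then a else 0) + (\<Sum>l<n. poly_entry A f i l * A $$ (l, j))"
proof -
  have pow: "(A ^\<^sub>m Suc k) $$ (i, j) = (\<Sum>l<n. (A ^\<^sub>m k) $$ (i, l) * A $$ (l, j))" for k
  proof -
    have "A ^\<^sub>m k \<in> carrier_mat n n" using A by simp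
    then show ?thesis using A ij by (auto simp: scalar_prod_def atLeast0LessThan)
  qed
  have "poly_entry A (pCons a f) i j
      = (\<Sum>k\<le>Suc (degree f). coeff (pCons a f) k * (A ^\<^sub>m k) $$ (i, j))"
    by (rule poly_entry_eq_sum) (rule degree_pCons_le)
  also have "\<dots> = a * (A ^\<^sub>m 0) $$ (i, j)
      + (\<Sum>k\<le>degree f. coeff f k * (A ^\<^sub>m Suc k) $$ (i, j))"
    by (simp add: sum.atMost_Suc_shift del: sum.atMost_Suc pow_mat.simps)
  also have "(\<Sum>k\<le>degree f. coeff f k * (A ^\<^sub>m Suc k) $$ (i, j))
      = (\<Sum>l<n. poly_entry A f i l * A $$ (l, j))"
    unfolding pow poly_entry_def sum_distrib_left sum_distrib_right
    by (subst sum.swap) (simp add: mult.assoc)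
  finally show ?thesis using A ij by simp
qed

lemma poly_entry_mult:
  assumes A: "A \<in> carrier_mat n n" and i: "i < n" and "j < n"
  shows "poly_entry A (f * g) i j = (\<Sum>l<n. poly_entry A f i l * poly_entry A g l j)"
  using \<open>j < n\<close>
proof (induction g arbitrary: j)
  case 0
  then show ?case by simp
next
  case (pCons a g)
  have *: "poly_entry A (f * pCons a g) i j
      = a * poly_entry A f i j + (\<Sum>l<n. poly_entry A (f * g) i l * A $$ (l, j))"
    using poly_entry_pCons[OF A i pCons.prems, of 0 "f * g"]
    by (simp add: poly_entry_add poly_entry_smult)
  have "(\<Sum>l<n. poly_entry A (f * g) i l * A $$ (l, j))
      = (\<Sum>l<n. \<Sum>m<n. poly_entry A f i m * poly_entry A g m l * A $$ (l, j))"
    using pCons.IH by (simp add: sum_distrib_right)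
  also have "\<dots> = (\<Sum>m<n. poly_entry A f i m * (\<Sum>l<n. poly_entry A g m l * A $$ (l, j)))"
    by (subst sum.swap) (simp add: sum_distrib_left mult.assoc)
  finally have "poly_entry A (f * pCons a g) i j = a * poly_entry A f i j
      + (\<Sum>m<n. poly_entry A f i m * (\<Sum>l<n. poly_entry A g m l * A $$ (l, j)))"
    using * by simp
  moreover have "(\<Sum>l<n. poly_entry A f i l * poly_entry A (pCons a g) l j)
     = (\<Sum>l<n. if l = j then a * poly_entry A f i l else 0)
      + (\<Sum>m<n. poly_entry A f i m * (\<Sum>l<n. poly_entry A g m l * A $$ (l, j)))"
    unfolding sum.distrib[symmetric]
    by (intro sum.cong refl) (simp add: poly_entry_pCons[OF A _ pCons.prems] algebra_simps)
  ultimately show ?case using pCons.prems by simp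
qed

text \<open>The Cayley--Hamilton theorem. Let polynomials act on column vectors through \<open>A\<close>; then the columns
  of \<open>X I - A\<close> are relations among the standard basis vectors. Multiplying by the adjugate replaces
  \<open>X I - A\<close> by its determinant.\<close>
lemma poly_entry_char_poly:
  assumes A: "A \<in> carrier_mat n n" and i: "i < n" and m: "m < n"
  shows "poly_entry A (char_poly A) i m = 0"
proof -
  define M where "M = char_poly_matrix A"
  define B where "B = adj_mat M"
  have M: "M \<in> carrier_mat n n" using A by (simp add: M_def)
  have B: "B \<in> carrier_mat n n" and MB: "M * B = char_poly A \<cdot>\<^sub>m 1\<^sub>m n"
    using adj_mat[OF M] by (simp_all add: B_def M_def char_poly_def)
  have M_entry: "M $$ (l, k) = (if l = k then [:0, 1:] else 0) + [:- A $$ (l, k):]"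
    if "l < n" "k < n" for l k
    using A that by (simp add: M_def char_poly_matrix_def)
  \<comment> \<open>Both \<open>X e_k\<close> and the sum of all \<open>A_{lk} e_l\<close> are column \<open>k\<close> of \<open>A\<close>.\<close>
  have ann: "(\<Sum>l<n. poly_entry A (M $$ (l, k)) r l) = 0" if r: "r < n" and k: "k < n" for r k
  proof -
    have X: "poly_entry A [:0, 1:] r l = A $$ (r, l)" if "l < n" for l
    proof -
      have "poly_entry A [:0, 1:] r l = (\<Sum>m<n. (if r = m then 1 else 0) * A $$ (m, l))"
        using A r that by (simp add: poly_entry_pCons[OF A])
      also have "\<dots> = (\<Sum>m<n. if r = m then A $$ (m, l) else 0)"
        by (intro sum.cong) auto
      finally show ?thesis using r by simp
    qed
    have "poly_entry A (M $$ (l, k)) r l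
        = (if l = k then A $$ (r, k) else 0) - (if r = l then A $$ (l, k) else 0)"
      if "l < n" for l
      using that r k X by (auto simp: M_entry poly_entry_add poly_entry_pCons[OF A])
    then show ?thesis using r k by (simp add: sum_subtractf)
  qed
  have "poly_entry A (char_poly A) i m
      = (\<Sum>l<n. poly_entry A (if l = m then char_poly A else 0) i l)"
    using m by (simp add: if_distrib if_distribR cong: if_cong)
  also have "\<dots> = (\<Sum>l<n. poly_entry A (\<Sum>k<n. B $$ (k, m) * M $$ (l, k)) i l)"
  proof (rule sum.cong)
    fix l assume "l \<in> {..<n}"
    then have l: "l < n" by simp
    have "(M * B) $$ (l, m) = (\<Sum>k<n. B $$ (k, m) * M $$ (l, k))"
      using M B l m by (simp add: scalar_prod_def atLeast0LessThan mult.commute)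
    moreover have "(M * B) $$ (l, m) = (if l = m then char_poly A else 0)"
      using l m by (simp add: MB)
    ultimately show "poly_entry A (if l = m then char_poly A else 0) i l
        = poly_entry A (\<Sum>k<n. B $$ (k, m) * M $$ (l, k)) i l"
      by (simp only:)
  qed simp
  also have "\<dots> = (\<Sum>l<n. \<Sum>k<n. poly_entry A (B $$ (k, m) * M $$ (l, k)) i l)"
  proof -
    have "poly_entry A (sum g I) i l = (\<Sum>k\<in>I. poly_entry A (g k) i l)" for g l and I :: "nat set"
      by (induction I rule: infinite_finite_induct) (auto simp: poly_entry_add)
    then show ?thesis by simp
  qed
  also have "\<dots> = (\<Sum>l<n. \<Sum>k<n. \<Sum>r<n.
      poly_entry A (B $$ (k, m)) i r * poly_entry A (M $$ (l, k)) r l)"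
    by (intro sum.cong refl) (simp add: poly_entry_mult[OF A i])
  also have "\<dots> = (\<Sum>k<n. \<Sum>l<n. \<Sum>r<n.
      poly_entry A (B $$ (k, m)) i r * poly_entry A (M $$ (l, k)) r l)"
    by (rule sum.swap)
  also have "\<dots> = (\<Sum>k<n. \<Sum>r<n. \<Sum>l<n.
      poly_entry A (B $$ (k, m)) i r * poly_entry A (M $$ (l, k)) r l)"
    by (rule sum.cong[OF refl], rule sum.swap)
  also have "\<dots> = 0"
    using ann by (simp add: sum_distrib_left[symmetric])
  finally show ?thesis .
qed

section \<open>Integer-valued polynomials on matrices\<close>

lemma Int_matrices_iff:
  fixes D :: "'k::field set"
  assumes D: "domain (subring_of D)"
  shows "f \<in> Int_matrices n D \<longleftrightarrow>
    (\<forall>A \<in> matrices_over n D. \<forall>i<n. \<forall>j<n. poly_entry A f i j \<in> D)"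
  using poly_mat_entry[where n = n and f = f]
  by (auto simp: Int_matrices_def matrices_over_iff[OF D])

lemma subring_set_of_domain:
  fixes D :: "'k::field set"
  assumes D: "domain (subring_of D)"
  shows "subring_set D"
proof
  fix a b assume ab: "a \<in> D" "b \<in> D"
  interpret D: domain "subring_of D" by (fact D)
  have "\<exists>b' \<in> D. b + b' = 0"
    using D.r_neg[of b] D.a_inv_closed[of b] ab(2) by (auto simp: ring_of_type_algebra_def)
  then have "- b \<in> D" by (metis minus_unique)
  then show "a - b \<in> D"
    using subring_closed(3)[OF D ab(1)] by fastforce
qed (simp_all add: subring_closed[OF D])

lemma subring_set_Int_matrices:
  fixes D :: "'k::field set"
  assumes D: "domain (subring_of D)"
  shows "subring_set (Int_matrices n D)"
proof -
  interpret D: subring_set D by (rule subring_set_of_domain[OF D])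
  show ?thesis
  proof
    show "1 \<in> Int_matrices n D"
      by (auto simp: Int_matrices_iff[OF D] one_pCons matrices_over_def poly_entry_pCons
          D.zero_mem D.one_mem)
  next
    fix f g assume fg: "f \<in> Int_matrices n D" "g \<in> Int_matrices n D"
    have "f - g = f + smult (- 1) g" by simp
    then have "poly_entry A (f - g) i j = poly_entry A f i j - poly_entry A g i j" for A i j
      by (simp only: poly_entry_add poly_entry_smult) simp
    then show "f - g \<in> Int_matrices n D"
      using fg by (simp add: Int_matrices_iff[OF D] D.diff_mem)
    show "f * g \<in> Int_matrices n D"
      unfolding Int_matrices_iff[OF D]
    proof (intro ballI allI impI)
      fix A i j assume *: "A \<in> matrices_over n D" "i < n" "j < n"
      then have "A \<in> carrier_mat n n" by (simp add: matrices_over_def)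
      then show "poly_entry A (f * g) i j \<in> D"
        using * fg by (auto simp: poly_entry_mult Int_matrices_iff[OF D]
            intro!: D.sum_mem D.mult_mem)
    qed
  qed
qed

lemma poly_mat_mem_of_mod_char_poly:
  fixes D :: "'k::field set"
  assumes D: "domain (subring_of D)"
    and A: "A \<in> matrices_over n D"
    and h: "a \<in> polys_over D" "char_poly A dvd h - a"
  shows "poly_mat n h A \<in> matrices_over n D"
proof -
  have A': "A \<in> carrier_mat n n" using A by (simp add: matrices_over_def)
  obtain q where q: "h = a + q * char_poly A"
    using h(2) by (metis add_diff_cancel_left' diff_add_cancel dvdE mult.commute add.commute)
  have "poly_entry A h i j = poly_entry A a i j" if "i < n" "j < n" for i j
    using that by (simp add: q poly_entry_add poly_entry_mult[OF A'] poly_entry_char_poly[OF A'])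
  moreover have "dim_row (poly_mat n g A) = n" "dim_col (poly_mat n g A) = n" for g
    using poly_mat_entry(1)[OF A', of g] by auto
  ultimately have "poly_mat n h A = poly_mat n a A"
    by (intro eq_matI) (simp_all add: poly_mat_entry(2)[OF A'])
  then show ?thesis
    using poly_mat_in_matrices_over[OF D _ A, of a] h(1) by (auto simp: polys_over_def)
qed

text \<open>The first row of \<open>f\<close> at the nilpotent Jordan block lists the lowest \<open>n\<close> coefficients of \<open>f\<close>.\<close>
lemma coeff_mem_of_Int_matrices:
  fixes D :: "'k::field set"
  assumes D: "domain (subring_of D)" and f: "f \<in> Int_matrices n D" and k: "k < n"
  shows "coeff f k \<in> D"
proof -
  define J where "J = jordan_block n (0 :: 'k)"
  have J: "J \<in> carrier_mat n n" by (simp add: J_def)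
  have "J \<in> matrices_over n D"
    using subring_closed[OF D] by (auto simp: matrices_over_iff[OF D] J_def jordan_block_def)
  then have mem: "poly_mat n f J \<in> matrices_over n D"
    using f by (auto simp: Int_matrices_def)
  have pow: "(J ^\<^sub>m i) $$ (0, k) = (if i = k then 1 else 0)" for i
    using k by (auto simp: J_def jordan_block_pow binomial_eq_0)
  have "poly_mat n f J $$ (0, k) = (\<Sum>i\<le>degree f. coeff f i * (if i = k then 1 else 0))"
    using k by (simp add: poly_mat_entry(2)[OF J] poly_entry_def pow)
  also have "\<dots> = (\<Sum>i\<le>degree f. if i = k then coeff f i else 0)"
    by (intro sum.cong) auto
  also have "\<dots> = coeff f k"
    by (simp add: coeff_eq_0)
  finally have entry: "poly_mat n f J $$ (0, k) = coeff f k" .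
  have "0 < n" using k by simp
  then have "poly_mat n f J $$ (0, k) \<in> D"
    using mem k by (simp add: matrices_over_iff[OF D])
  then show ?thesis by (simp only: entry)
qed

text \<open>The monic equation is \<open>\<phi>(Y) - \<phi>(f) = 0\<close>: the coefficients of \<open>\<phi>\<close> are constants from \<open>D\<close> and the
  correction \<open>\<phi>(f)\<close> affects the constant coefficient only.\<close>
lemma integral_over_Int_matrices:
  fixes D :: "'k::field set"
  assumes D: "domain (subring_of D)"
    and Int: "subring_set (Int_matrices n D)"
    and \<phi>: "lead_coeff \<phi> = 1" "degree \<phi> > 0" "\<phi> \<in> polys_over D"
    and f: "pcompose \<phi> f \<in> Int_matrices n D"
  shows "integral_over (to_fract ` Int_matrices n D) (to_fract f)"
proof -
  interpret subring_set "Int_matrices n D" by (fact Int)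
  have const: "[:d:] \<in> Int_matrices n D" if "d \<in> D" for d
    using poly_mat_in_matrices_over[OF D, of "[:d:]"] that subring_closed(1)[OF D]
    by (auto simp: Int_matrices_def coeff_pCons split: nat.splits)
  define emb :: "'k \<Rightarrow> 'k poly fract" where "emb d = to_fract [:d:]" for d
  have emb0: "emb 0 = 0" and emb1: "emb 1 = 1"
    by (simp_all add: emb_def flip: one_pCons)
  define p where "p = map_poly emb \<phi> - [:to_fract (pcompose \<phi> f):]"
  have coeff_p: "coeff p i = to_fract ([:coeff \<phi> i:] - (if i = 0 then pcompose \<phi> f else 0))" for i
    by (simp add: p_def coeff_map_poly emb0 coeff_pCons split: nat.splits) (simp add: emb_def)
  have "degree p = degree \<phi>"
  proof (rule antisym)
    show "degree p \<le> degree \<phi>"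
      by (rule degree_le) (use \<phi>(2) in \<open>auto simp: coeff_p coeff_eq_0\<close>)
    show "degree \<phi> \<le> degree p"
      by (rule le_degree) (use \<phi>(1,2) in \<open>auto simp: coeff_p\<close>)
  qed
  then have "lead_coeff p = 1"
    using \<phi>(1,2) by (simp add: coeff_p flip: one_pCons)
  moreover have "coeff p i \<in> to_fract ` Int_matrices n D" for i
    unfolding coeff_p using const[of "coeff \<phi> i"] f \<phi>(3)
    by (intro imageI) (auto simp: polys_over_def zero_mem intro: diff_mem)
  moreover have "poly p (to_fract f) = 0"
  proof -
    have "poly (map_poly emb \<psi>) (to_fract f) = to_fract (pcompose \<psi> f)" for \<psi>
      by (induction \<psi>) (simp_all add: map_poly_pCons emb0 pcompose_pCons, simp add: emb_def)
    then show ?thesis by (simp add: p_def)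
  qed
  ultimately show ?thesis unfolding integral_over_def by blast
qed

section \<open>A denominator with prime conductor\<close>

text \<open>The element \<open>t\<close> is a denominator whose conductor \<open>{d \<in> D. t d \<in> D}\<close> is a nonzero prime ideal, and
  \<open>R\<close> is a finite set of representatives of the residue classes modulo that ideal.\<close>
locale denominator_prime = subring_set D for D :: "'k::field set" +
  fixes t :: 'k and R :: "'k set"
  assumes t_notin: "t \<notin> D"
    and prime: "\<lbrakk>a \<in> D; b \<in> D; t * (a * b) \<in> D\<rbrakk> \<Longrightarrow> t * a \<in> D \<or> t * b \<in> D"
    and nonzero: "\<exists>q \<in> D. q \<noteq> 0 \<and> t * q \<in> D"
    and finite_R: "finite R"
    and R_subset: "R \<subseteq> D"
    and representative: "d \<in> D \<Longrightarrow> \<exists>r \<in> R. t * (d - r) \<in> D"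
begin

definition P :: "'k set" where
  "P = {d \<in> D. t * d \<in> D}"

sublocale P: ideal_set D P
  by unfold_locales
    (auto simp: P_def zero_mem diff_mem mult_mem right_diff_distrib mult.left_commute[of t])

sublocale DX: subring_set "polys_over D"
  by (rule subring_set_polys_over)

sublocale PX: ideal_set "polys_over D" "polys_over P"
  by (rule P.ideal_set_polys_over)

lemma one_notin_P: "1 \<notin> P"
  using t_notin by (simp add: P_def)

lemma P_prime: "\<lbrakk>a \<in> D; b \<in> D; a * b \<in> P\<rbrakk> \<Longrightarrow> a \<in> P \<or> b \<in> P"
  using prime by (auto simp: P_def)

lemma prod_notin_P:
  assumes "\<And>i. i \<in> I \<Longrightarrow> g i \<in> D - P"
  shows "prod g I \<notin> P"
  using assms
proof (induction I rule: infinite_finite_induct)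
  case (insert i I)
  then show ?case using P_prime[of "g i" "prod g I"] prod_mem[of I g] by auto
qed (auto simp: one_notin_P)

lemma representative_P: "d \<in> D \<Longrightarrow> \<exists>r \<in> R. d - r \<in> P"
  using representative R_subset diff_mem by (fastforce simp: P_def)

lemma cong_P_iff: "a - b \<in> P \<Longrightarrow> a \<in> P \<longleftrightarrow> b \<in> P"
  using P.ideal_add[of "a - b" b] P.ideal_diff[of a "a - b"] by auto

lemma monom_mem: "a \<in> D \<Longrightarrow> monom a k \<in> polys_over D"
  by (auto simp: polys_over_def zero_mem)

lemma smult_t_mem: "f \<in> polys_over P \<Longrightarrow> smult t f \<in> polys_over D"
  by (auto simp: polys_over_def P_def)

text \<open>For \<open>d \<notin> P\<close> two of the powers \<open>d ^ 0, \<dots>, d ^ card R\<close> are congruent, so the order of \<open>d\<close> modulo \<open>P\<close> is at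
  most \<open>card R\<close>; the factorial is divisible by all possible orders.\<close>
definition unit_exponent :: nat where
  "unit_exponent = fact (card R)"

lemma unit_exponent_pos: "unit_exponent > 0"
  by (simp add: unit_exponent_def)

lemma power_unit_exponent:
  assumes d: "d \<in> D" "d \<notin> P"
  shows "d ^ unit_exponent - 1 \<in> P"
proof -
  have "\<forall>k. \<exists>r \<in> R. d ^ k - r \<in> P"
    using representative_P power_mem[OF d(1)] by blast
  then obtain rep where rep: "\<And>k. rep k \<in> R" "\<And>k. d ^ k - rep k \<in> P" by metis
  have "\<not> inj_on rep {..card R}"
  proof
    assume "inj_on rep {..card R}"
    then have "card {..card R} \<le> card R"
      using card_inj_on_le[OF _ _ finite_R] rep(1) by blast
    then show False by simp
  qed
  then obtain i j where ij: "i < j" "j \<le> card R" "rep i = rep j"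
    unfolding inj_on_def by (metis atMost_iff linorder_neqE_nat)
  define m where "m = j - i"
  have "d ^ j - d ^ i \<in> P"
    using P.ideal_diff[OF rep(2)[of j] rep(2)[of i]] ij by simp
  moreover have "d ^ j - d ^ i = d ^ i * (d ^ m - 1)"
    using ij by (simp add: m_def right_diff_distrib flip: power_add)
  moreover have "d ^ i \<notin> P"
    using prod_notin_P[of "{..<i}" "\<lambda>_. d"] d by simp
  ultimately have m: "d ^ m - 1 \<in> P"
    using P_prime[of "d ^ i" "d ^ m - 1"] d by (auto simp: diff_mem power_mem one_mem)
  have "m dvd unit_exponent"
    unfolding unit_exponent_def m_def using ij by (intro dvd_fact) auto
  then obtain l where "unit_exponent = m * l" by blast
  then show ?thesis
    using P.cong_power[OF m, of l] d by (simp add: power_mult power_mem one_mem)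
qed

text \<open>Take for \<open>w\<close> the product of all polynomials of degree at most \<open>n\<close> with coefficients in \<open>R\<close> and
  constant term outside \<open>P\<close>. If not all low coefficients of \<open>\<chi>\<close> lie in \<open>P\<close>, then
  \<open>\<chi> \<equiv> X^j u\<close> modulo \<open>P\<close> for some \<open>j < n\<close> and one of the factors \<open>u\<close>, so \<open>X^{n-1} w\<close> is a multiple
  of \<open>\<chi>\<close> modulo \<open>P\<close>, and \<open>t\<close> cancels the error.\<close>
lemma residue_cofactor:
  obtains w where "w \<in> polys_over D" "coeff w 0 \<notin> P"
    "\<And>\<chi>. \<lbrakk>\<chi> \<in> polys_over D; degree \<chi> \<le> n; \<exists>i<n. coeff \<chi> i \<notin> P\<rbrakk>
       \<Longrightarrow> smult t (monom 1 (n - 1) * w) \<in> polys_mod \<chi>"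
proof -
  define lift :: "(nat \<Rightarrow> 'k) \<Rightarrow> 'k poly" where "lift g = (\<Sum>i\<le>n. monom (g i) i)" for g
  define U where "U = {u \<in> lift ` ({..n} \<rightarrow>\<^sub>E R). coeff u 0 \<notin> P}"
  define w where "w = \<Prod>U"
  have coeff_lift: "coeff (lift g) k = (if k \<le> n then g k else 0)" for g k
    by (simp add: lift_def coeff_sum coeff_monom)
  have "finite U"
    unfolding U_def using finite_R by (simp add: finite_PiE)
  have U_subset: "U \<subseteq> polys_over D"
  proof
    fix u assume "u \<in> U"
    then obtain g where "u = lift g" "g \<in> {..n} \<rightarrow>\<^sub>E R" by (auto simp: U_def)
    then have "coeff u i \<in> D" for i
      using PiE_mem[of g "{..n}" "\<lambda>_. R" i] R_subset zero_mem by (auto simp: coeff_lift)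
    then show "u \<in> polys_over D" by (simp add: polys_over_def)
  qed
  show thesis
  proof (rule that)
    show "w \<in> polys_over D"
      unfolding w_def using U_subset by (intro DX.prod_mem) auto
    have "coeff w 0 = (\<Prod>u\<in>U. coeff u 0)"
      by (simp add: w_def poly_prod flip: poly_0_coeff_0)
    moreover have "(\<Prod>u\<in>U. coeff u 0) \<notin> P"
      using U_subset by (intro prod_notin_P) (auto simp: U_def polys_over_def)
    ultimately show "coeff w 0 \<notin> P" by simp
  next
    fix \<chi> assume \<chi>: "\<chi> \<in> polys_over D" "degree \<chi> \<le> n" and ex: "\<exists>i<n. coeff \<chi> i \<notin> P"
    define j where "j = (LEAST i. coeff \<chi> i \<notin> P)"
    have j: "j < n" "coeff \<chi> j \<notin> P"
    proof -
      obtain i where "i < n" "coeff \<chi> i \<notin> P" using ex by blast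
      then show "coeff \<chi> j \<notin> P" "j < n"
        unfolding j_def using LeastI[of "\<lambda>i. coeff \<chi> i \<notin> P" i]
          Least_le[of "\<lambda>i. coeff \<chi> i \<notin> P" i] by auto
    qed
    have below: "coeff \<chi> i \<in> P" if "i < j" for i
      using not_less_Least that unfolding j_def by blast
    have "\<forall>i. \<exists>r \<in> R. coeff \<chi> i - r \<in> P"
      using representative_P \<chi>(1) by (auto simp: polys_over_def)
    then obtain rep where rep: "\<And>i. rep i \<in> R" "\<And>i. coeff \<chi> i - rep i \<in> P" by metis
    define u where "u = lift (restrict (\<lambda>i. rep (i + j)) {..n})"
    have coeff_u: "coeff u k = (if k \<le> n then rep (k + j) else 0)" for k
      by (simp add: u_def coeff_lift)
    have "u \<in> U"
      using rep(1) j(2) cong_P_iff[OF rep(2)[of j]]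
      by (auto simp: U_def coeff_u u_def coeff_lift)
    define w' where "w' = \<Prod>(U - {u})"
    have w': "w = u * w'" "w' \<in> polys_over D"
      using \<open>finite U\<close> \<open>u \<in> U\<close> U_subset
      by (auto simp: w_def w'_def prod.remove intro!: DX.prod_mem)
    define \<delta> where "\<delta> = \<chi> - monom 1 j * u"
    have "coeff \<delta> i \<in> P" for i
    proof (cases "j \<le> i \<and> i - j \<le> n")
      case True
      then show ?thesis using rep(2)[of i] by (simp add: \<delta>_def coeff_monom_mult coeff_u)
    next
      case False
      then have "coeff \<delta> i = coeff \<chi> i" by (auto simp: \<delta>_def coeff_monom_mult coeff_u)
      moreover have "coeff \<chi> i \<in> P"
        using False below[of i] \<chi>(2) P.ideal_zero by (cases "i < j") (auto simp: coeff_eq_0)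
      ultimately show ?thesis by simp
    qed
    then have \<delta>: "smult t \<delta> \<in> polys_over D"
      by (intro smult_t_mem) (simp add: polys_over_def)
    define v where "v = monom 1 (n - 1 - j) * w'"
    have v: "v \<in> polys_over D"
      using w' by (auto simp: v_def intro!: DX.mult_mem monom_mem one_mem)
    have "(monom 1 (n - 1) :: 'k poly) = monom 1 (n - 1 - j) * monom 1 j"
      using j(1) by (simp add: mult_monom)
    then have "monom 1 (n - 1) * w = v * (monom 1 j * u)"
      by (simp only: v_def w'(1) mult_ac)
    also have "\<dots> = v * (\<chi> - \<delta>)" by (simp add: \<delta>_def)
    finally have shifted: "monom 1 (n - 1) * w = v * (\<chi> - \<delta>)" .
    have "smult t (monom 1 (n - 1) * w) - (- (v * smult t \<delta>)) = \<chi> * smult t v"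
      unfolding shifted by (simp add: right_diff_distrib smult_diff_right mult.commute)
    then show "smult t (monom 1 (n - 1) * w) \<in> polys_mod \<chi>"
      unfolding polys_mod_def using DX.uminus_mem[OF DX.mult_mem[OF v \<delta>]]
      by (metis (mono_tags, lifting) dvd_triv_left mem_Collect_eq)
  qed
qed

end

lemma ideal_annihilator:
  fixes D :: "'k::field set"
  assumes D: "domain (subring_of D)"
  shows "ideal {d \<in> D. y * d \<in> D} (subring_of D)"
proof -
  interpret S: subring_set D by (rule subring_set_of_domain[OF D])
  interpret R: domain "subring_of D" by (fact D)
  have carrier: "carrier (subring_of D) = D"
    and add: "\<And>a b. a \<oplus>\<^bsub>subring_of D\<^esub> b = a + b"
    and mult: "\<And>a b. a \<otimes>\<^bsub>subring_of D\<^esub> b = a * b"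
    and zero: "\<zero>\<^bsub>subring_of D\<^esub> = 0"
    by (simp_all add: ring_of_type_algebra_def)
  have neg: "\<ominus>\<^bsub>subring_of D\<^esub> a = - a" if "a \<in> D" for a
    using R.r_neg[of a] that unfolding carrier add zero by (metis minus_unique)
  show ?thesis
  proof (rule idealI[OF R.ring_axioms])
    show "subgroup {d \<in> D. y * d \<in> D} (add_monoid (subring_of D))"
    proof
      fix x assume "x \<in> {d \<in> D. y * d \<in> D}"
      then show "inv\<^bsub>add_monoid (subring_of D)\<^esub> x \<in> {d \<in> D. y * d \<in> D}"
        using neg[of x] by (auto simp: a_inv_def S.uminus_mem)
    qed (auto simp: ring_of_type_algebra_def S.zero_mem S.add_mem distrib_left)
  next
    fix a x assume "a \<in> {d \<in> D. y * d \<in> D}" "x \<in> carrier (subring_of D)"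
    then have ax: "x * a \<in> D" "y * (x * a) \<in> D"
      using S.mult_mem[of x "y * a"] by (auto simp: carrier S.mult_mem mult.left_commute)
    then show "x \<otimes>\<^bsub>subring_of D\<^esub> a \<in> {d \<in> D. y * d \<in> D}"
      by (simp only: mult mem_Collect_eq)
    show "a \<otimes>\<^bsub>subring_of D\<^esub> x \<in> {d \<in> D. y * d \<in> D}"
      using ax by (simp only: mult mem_Collect_eq mult.commute[of a x])
  qed
qed

text \<open>A maximal annihilator of a module is prime; this is applied to the module \<open>K / D\<close>, in which the
  annihilator of the class of \<open>y\<close> is \<open>{d \<in> D. y d \<in> D}\<close>.\<close>
lemma exists_denominator_prime:
  fixes D :: "'k::field set"
  assumes dedekind: "dedekind_domain D" and not_field: "\<not> field (subring_of D)"
    and finite: "finite_residue_fields D" and frac: "fraction_field D = UNIV"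
  shows "\<exists>t R. denominator_prime D t R"
proof -
  let ?R = "subring_of D"
  interpret R: noetherian_domain ?R
    using dedekind by (simp add: dedekind_domain_def)
  have D: "domain ?R" by (rule R.domain_axioms)
  interpret S: subring_set D by (rule subring_set_of_domain[OF D])
  have carrier: "carrier ?R = D"
    and add: "\<And>a b. a \<oplus>\<^bsub>?R\<^esub> b = a + b"
    and mult: "\<And>a b. a \<otimes>\<^bsub>?R\<^esub> b = a * b"
    by (simp_all add: ring_of_type_algebra_def)
  define ann where "ann y = {d \<in> D. y * d \<in> D}" for y
  have ideal_ann: "ideal (ann y) ?R" for y
    unfolding ann_def by (rule ideal_annihilator[OF D])
  define \<A> where "\<A> = ann ` (- D)"
  have "D \<noteq> UNIV"
  proof
    assume "D = UNIV"
    then have "?R = (ring_of_type_algebra :: 'k ring)" by (simp add: ring_of_type_algebra_def)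
    then show False using not_field field_from_type_algebra by metis
  qed
  then have nonempty: "\<A> \<noteq> {}" by (auto simp: \<A>_def)
  have chain: "\<Union>C \<in> \<A>" if "C \<noteq> {}" "subset.chain \<A> C" for C
  proof -
    have "subset.chain {I. ideal I ?R} C"
      using that(2) ideal_ann unfolding pred_on.chain_def \<A>_def by blast
    then have "\<Union>C \<in> C" using R.ideal_chain_is_trivial that(1) by blast
    then show ?thesis using that(2) unfolding pred_on.chain_def by blast
  qed
  obtain I where I: "I \<in> \<A>" "\<forall>J\<in>\<A>. I \<subseteq> J \<longrightarrow> J = I"
    using subset_Zorn_nonempty[OF nonempty chain] by blast
  then obtain t where t: "t \<notin> D" "I = ann t" by (auto simp: \<A>_def)
  then have maximal: "ann y = ann t" if "y \<notin> D" "ann t \<subseteq> ann y" for y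
    using I(2) that by (auto simp: \<A>_def)
  have prime: "b \<in> ann t" if "a \<in> D" "b \<in> D" "a * b \<in> ann t" "a \<notin> ann t" for a b
  proof -
    \<comment> \<open>Passing from \<open>t\<close> to \<open>t a\<close> enlarges the annihilator, so maximality leaves it unchanged.\<close>
    have "t * a \<notin> D" using that by (simp add: ann_def)
    moreover have "ann t \<subseteq> ann (t * a)"
    proof
      fix d assume "d \<in> ann t"
      then show "d \<in> ann (t * a)"
        using S.mult_mem[OF that(1), of "t * d"] by (simp add: ann_def mult_ac)
    qed
    ultimately have "ann (t * a) = ann t" using maximal by blast
    moreover have "b \<in> ann (t * a)" using that by (simp add: ann_def mult_ac)
    ultimately show ?thesis by simp
  qed
  have "t \<in> fraction_field D" using frac by simp
  \<comment> \<open>The denominator \<open>q\<close> of the fraction \<open>t\<close> shows that the annihilator is not zero.\<close>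
  then obtain x q where q: "q \<in> D" "q \<noteq> 0" "t * q \<in> D"
    unfolding fraction_field_def by auto
  then have nonzero: "\<exists>q\<in>D. q \<noteq> 0 \<and> t * q \<in> D" by blast
  have "primeideal (ann t) ?R"
  proof (rule primeidealI[OF ideal_ann R.is_cring])
    have "1 \<notin> ann t" using t(1) by (simp add: ann_def)
    then show "carrier ?R \<noteq> ann t" unfolding carrier using S.one_mem by blast
    show "a \<in> ann t \<or> b \<in> ann t"
      if "a \<in> carrier ?R" "b \<in> carrier ?R" "a \<otimes>\<^bsub>?R\<^esub> b \<in> ann t" for a b
      using prime[of a b] that unfolding carrier mult by blast
  qed
  moreover have "ann t \<noteq> {0}" using q by (auto simp: ann_def)
  ultimately have "maximalideal (ann t) ?R"
    using dedekind by (simp add: dedekind_domain_def)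
  then have "finite (carrier (?R Quot ann t))"
    using finite by (simp add: finite_residue_fields_def)
  moreover have "carrier (?R Quot ann t) = (\<lambda>d. (\<lambda>h. h + d) ` ann t) ` D"
  proof -
    have coset: "ann t +>\<^bsub>?R\<^esub> d = (\<lambda>h. h + d) ` ann t" for d
      unfolding a_r_coset_def' add by auto
    have "carrier (?R Quot ann t) = (\<Union>d\<in>carrier ?R. {ann t +>\<^bsub>?R\<^esub> d})"
      by (simp add: FactRing_def A_RCOSETS_def')
    then show ?thesis unfolding coset carrier by auto
  qed
  ultimately have fin: "finite ((\<lambda>d. (\<lambda>h. h + d) ` ann t) ` D)" by simp
  define R where "R = (\<lambda>C. SOME x. x \<in> C) ` (\<lambda>d. (\<lambda>h. h + d) ` ann t) ` D"
  have zero: "0 \<in> ann t" by (simp add: ann_def S.zero_mem)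
  have some: "\<exists>h \<in> ann t. (SOME x. x \<in> (\<lambda>h. h + d) ` ann t) = h + d" for d
    using someI[of "\<lambda>x. x \<in> (\<lambda>h. h + d) ` ann t" "0 + d"] zero by auto
  have "denominator_prime D t R"
  proof
    show "t \<notin> D" by (fact t(1))
    show "\<exists>q\<in>D. q \<noteq> 0 \<and> t * q \<in> D" by (fact nonzero)
    show "finite R" unfolding R_def using fin by (rule finite_imageI)
    show "R \<subseteq> D"
    proof
      fix r assume "r \<in> R"
      then obtain d where "d \<in> D" "r = (SOME x. x \<in> (\<lambda>h. h + d) ` ann t)"
        unfolding R_def by blast
      then show "r \<in> D" using some[of d] S.add_mem by (auto simp: ann_def)
    qed
    fix d assume "d \<in> D"
    define r where "r = (SOME x. x \<in> (\<lambda>h. h + d) ` ann t)"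
    obtain h where "h \<in> ann t" "r = h + d" using some[of d] by (auto simp: r_def)
    then have "t * (d - r) \<in> D" using S.uminus_mem[of "t * h"] by (simp add: ann_def)
    moreover have "r \<in> R" unfolding R_def r_def using \<open>d \<in> D\<close> by blast
    ultimately show "\<exists>r\<in>R. t * (d - r) \<in> D" by blast
  next
    fix a b assume "a \<in> D" "b \<in> D" "t * (a * b) \<in> D"
    then show "t * a \<in> D \<or> t * b \<in> D"
      using prime[of a b] by (auto simp: ann_def S.mult_mem)
  qed
  then show ?thesis by blast
qed

section \<open>Degenerate moduli\<close>

text \<open>A modulus \<open>\<chi>\<close> that is \<open>X^n\<close> modulo \<open>P\<close> and for which the constant term of \<open>t X^n\<close> reduced modulo
  \<open>\<chi>\<close> lies in \<open>P\<close> as well. If \<open>P\<close> is generated by \<open>\<pi>\<close>, then \<open>\<pi>^2\<close> divides the constant term of \<open>\<chi>\<close>, and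
  \<open>D[X] / (\<chi>)\<close> is singular at the ideal generated by \<open>\<pi>\<close> and \<open>X\<close>: this is why fractions like \<open>b\<close>
  below can be integral over it.\<close>
locale degenerate_modulus = denominator_prime D t R
  for D :: "'k::field set" and t R +
  fixes n :: nat and \<chi> :: "'k poly" and c :: 'k and s :: "'k poly"
  assumes n: "n \<ge> 2"
    and lower: "\<chi> - monom 1 n \<in> polys_over P"
    and c: "c \<in> P"
    and s: "s \<in> polys_over D"
    and reduction: "smult t (monom 1 n) = pCons c s + smult t \<chi>"
begin

text \<open>The element \<open>b\<close> is integral over \<open>D[X]\<close> modulo \<open>\<chi>\<close>. Shifting it by \<open>s\<close> gives \<open>\<beta>\<close>, whose product
  with \<open>X\<close> is the constant \<open>c\<close>.\<close>
definition b :: "'k poly" where "b = smult t (monom 1 (n - 1))"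

definition \<beta> :: "'k poly" where "\<beta> = b - s"

text \<open>The ideal \<open>Q k\<close> contains the \<open>k\<close>-th power of \<open>P\<close>, and \<open>M k\<close> is \<open>Q k\<close> times the ring generated
  by \<open>\<beta>\<close> over \<open>D[X] + \<chi> K[X]\<close>; that ring itself is \<open>M 0\<close>.\<close>
definition Q :: "nat \<Rightarrow> 'k set" where
  "Q k = {q \<in> D. \<forall>i\<le>k. t ^ i * q \<in> D}"

definition gens :: "nat \<Rightarrow> 'k poly set" where
  "gens k = {[:q:] * a * \<beta> ^ j | q a j. q \<in> Q k \<and> a \<in> polys_mod \<chi>}"

definition M :: "nat \<Rightarrow> 'k poly set" where
  "M k = group_closure (gens k)"

sublocale T: subring_set "polys_mod \<chi>"
  by (rule subring_set_polys_mod)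

lemma DX_T: "f \<in> polys_over D \<Longrightarrow> f \<in> polys_mod \<chi>"
  using polys_over_subset_polys_mod by blast

lemma const_mem_T: "d \<in> D \<Longrightarrow> [:d:] \<in> polys_mod \<chi>"
  by (intro DX_T) simp

lemma X_beta: "monom 1 1 * \<beta> = [:c:] + smult t \<chi>"
proof -
  have "monom 1 1 * \<beta> = smult t (monom 1 n) - monom 1 1 * s"
    using n by (simp add: \<beta>_def b_def right_diff_distrib mult_monom)
  moreover have "pCons c s = [:c:] + monom 1 1 * s"
    by (simp add: monom_altdef)
  ultimately show ?thesis
    by (simp only: reduction) simp
qed

text \<open>\<open>b \<beta>^{n-1} = t (X \<beta>)^{n-1}\<close>.\<close>
lemma norm_beta: "\<chi> dvd b * \<beta> ^ (n - 1) - [:t * c ^ (n - 1):]"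
proof -
  have "b * \<beta> ^ (n - 1) = smult t ((monom 1 1 * \<beta>) ^ (n - 1))"
    by (simp add: b_def power_mult_distrib monom_power)
  then have "b * \<beta> ^ (n - 1) - [:t * c ^ (n - 1):]
      = smult t ((monom 1 1 * \<beta>) ^ (n - 1) - [:c:] ^ (n - 1))"
    by (simp add: smult_diff_right poly_const_pow)
  moreover have "\<chi> dvd (monom 1 1 * \<beta>) ^ (n - 1) - [:c:] ^ (n - 1)"
    by (rule dvd_diff_power) (unfold X_beta, simp add: dvd_smult)
  ultimately show ?thesis by (simp add: dvd_smult)
qed

text \<open>One factor \<open>c\<close> absorbs \<open>t\<close>, and \<open>n \<ge> 2\<close> provides one.\<close>
lemma norm_mem: "t * c ^ (n - 1) \<in> D"
proof -
  have "c ^ (n - 1) = c ^ (n - 2) * c"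
  proof -
    have "n - 1 = Suc (n - 2)" using n by simp
    then show ?thesis by (simp only: power_Suc2)
  qed
  then have "t * c ^ (n - 1) = c ^ (n - 2) * (t * c)" by simp
  then show ?thesis using c by (simp only: P_def mem_Collect_eq mult_mem power_mem)
qed

text \<open>Powers of \<open>\<beta>\<close> below the \<open>n\<close>-th involve at most \<open>n - 1\<close> factors \<open>t\<close>, and \<open>q\<close> cancels them.
  Higher powers are reduced by \<open>\<beta>^n = b \<beta>^{n-1} - s \<beta>^{n-1}\<close>, where \<open>b \<beta>^{n-1}\<close> lies in
  \<open>D[X] + \<chi> K[X]\<close>.\<close>
lemma beta_power_mem:
  assumes q: "q \<in> Q (n - 1)"
  shows "[:q:] * \<beta> ^ j \<in> polys_mod \<chi>"
proof (induction j rule: less_induct)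
  case (less j)
  have low: "[:q:] * b ^ i * \<beta> ^ l \<in> polys_mod \<chi>" if "i + l \<le> n - 1" for i l
    using that
  proof (induction l arbitrary: i)
    case 0
    have "[:q:] * b ^ i = smult (t ^ i * q) (monom 1 ((n - 1) * i))"
      by (simp add: b_def smult_power monom_power mult.commute)
    then show ?case
      using q 0 by (simp add: Q_def smult_monom DX_T monom_mem)
  next
    case (Suc l)
    have "[:q:] * b ^ i * \<beta> ^ Suc l = [:q:] * b ^ Suc i * \<beta> ^ l - s * ([:q:] * b ^ i * \<beta> ^ l)"
      by (simp add: \<beta>_def algebra_simps)
    moreover have "\<dots> \<in> polys_mod \<chi>"
      using Suc.prems by (intro T.diff_mem T.mult_mem DX_T[OF s] Suc.IH) auto
    ultimately show ?case by (simp only:)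
  qed
  show ?case
  proof (cases "j \<le> n - 1")
    case True
    then show ?thesis using low[of 0 j] by simp
  next
    case False
    have "b * \<beta> ^ (n - 1) \<in> polys_mod \<chi>"
      using norm_beta norm_mem by (auto simp: polys_mod_def intro!: bexI[of _ "[:t * c ^ (n - 1):]"])
    moreover have "[:q:] * \<beta> ^ j
        = b * \<beta> ^ (n - 1) * ([:q:] * \<beta> ^ (j - n)) - s * ([:q:] * \<beta> ^ (j - 1))"
    proof -
      have "\<beta> ^ j = \<beta> * \<beta> ^ (n - 1) * \<beta> ^ (j - n)"
        using False n by (simp flip: power_add power_Suc)
      also have "\<dots> = (b - s) * (\<beta> ^ (n - 1) * \<beta> ^ (j - n))"
        by (simp only: \<beta>_def[symmetric] mult.assoc)
      finally have "\<beta> ^ j = (b - s) * (\<beta> ^ (n - 1) * \<beta> ^ (j - n))" .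
      moreover have "\<beta> ^ (j - 1) = \<beta> ^ (n - 1) * \<beta> ^ (j - n)"
        using False n by (simp flip: power_add)
      ultimately show ?thesis by (simp only: left_diff_distrib right_diff_distrib mult_ac)
    qed
    moreover have "[:q:] * \<beta> ^ (j - n) \<in> polys_mod \<chi>" "[:q:] * \<beta> ^ (j - 1) \<in> polys_mod \<chi>"
      using less[of "j - n"] less[of "j - 1"] False n by auto
    ultimately show ?thesis
      using DX_T[OF s] by (simp only: T.diff_mem T.mult_mem)
  qed
qed

lemma M_subset: "M (n - 1) \<subseteq> polys_mod \<chi>"
  unfolding M_def
proof (rule group_closure_subset)
  show "gens (n - 1) \<subseteq> polys_mod \<chi>"
  proof
    fix g assume "g \<in> gens (n - 1)"
    then obtain q a j where "g = [:q:] * a * \<beta> ^ j" "q \<in> Q (n - 1)" "a \<in> polys_mod \<chi>"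
      unfolding gens_def by blast
    moreover have "[:q:] * a * \<beta> ^ j = a * ([:q:] * \<beta> ^ j)" by simp
    ultimately show "g \<in> polys_mod \<chi>"
      using beta_power_mem T.mult_mem by metis
  qed
qed (auto simp: T.zero_mem T.diff_mem)

lemma gen_mem_M: "q \<in> Q k \<Longrightarrow> a \<in> polys_mod \<chi> \<Longrightarrow> [:q:] * a * \<beta> ^ j \<in> M k"
  unfolding M_def gens_def by (intro group_closure.base) blast

lemma Q_mult: "p \<in> Q k \<Longrightarrow> q \<in> Q l \<Longrightarrow> p * q \<in> Q (k + l)"
proof -
  assume p: "p \<in> Q k" and q: "q \<in> Q l"
  have "t ^ i * (p * q) \<in> D" if "i \<le> k + l" for i
  proof -
    have "i = min i k + (i - min i k)" by simp
    then have "t ^ i * (p * q) = (t ^ min i k * p) * (t ^ (i - min i k) * q)"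
      by (metis (no_types, lifting) mult.assoc mult.left_commute power_add)
    moreover have "t ^ min i k * p \<in> D" "t ^ (i - min i k) * q \<in> D"
      using p q that by (auto simp: Q_def)
    ultimately show ?thesis by (simp only: mult_mem)
  qed
  then show ?thesis using p q by (auto simp: Q_def mult_mem)
qed

lemma M_mult: "f \<in> M k \<Longrightarrow> g \<in> M l \<Longrightarrow> f * g \<in> M (k + l)"
  unfolding M_def
proof (rule group_closure_mult)
  fix g h assume "g \<in> gens k" "h \<in> gens l"
  then obtain q a j q' a' j'
    where "g = [:q:] * a * \<beta> ^ j" "q \<in> Q k" "a \<in> polys_mod \<chi>"
      and "h = [:q':] * a' * \<beta> ^ j'" "q' \<in> Q l" "a' \<in> polys_mod \<chi>"
    unfolding gens_def by blast
  moreover from this have "g * h = [:q * q':] * (a * a') * \<beta> ^ (j + j')"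
    by (simp add: power_add mult_ac)
  ultimately show "g * h \<in> group_closure (gens (k + l))"
    using gen_mem_M[OF Q_mult T.mult_mem] unfolding M_def by metis
qed

lemma M_diff: "f \<in> M k \<Longrightarrow> g \<in> M k \<Longrightarrow> f - g \<in> M k"
  unfolding M_def by (rule group_closure.diff)

lemma T_subset_M0: "a \<in> polys_mod \<chi> \<Longrightarrow> a \<in> M 0"
  using gen_mem_M[of 1 0 a 0] by (simp add: Q_def one_mem flip: one_pCons)

sublocale S: subring_set "M 0"
  by unfold_locales (use T_subset_M0[OF T.one_mem] M_diff M_mult[of _ 0 _ 0] in auto)

lemma beta_mem_S: "\<beta> \<in> M 0"
  using gen_mem_M[of 1 0 1 1] T.one_mem by (simp add: Q_def one_mem flip: one_pCons)

lemma P_subset_Q1: "p \<in> P \<Longrightarrow> p \<in> Q (Suc 0)"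
  by (auto simp: P_def Q_def le_Suc_eq)

sublocale M1: ideal_set "M 0" "M (Suc 0)"
proof
  have "gens (Suc 0) \<subseteq> gens 0"
    by (force simp: gens_def Q_def)
  then show "M (Suc 0) \<subseteq> M 0"
    unfolding M_def
    by (intro group_closure_subset) (auto intro: group_closure.base group_closure.diff)
  show "0 \<in> M (Suc 0)"
    unfolding M_def by (rule group_closure.base) simp
qed (use M_diff M_mult[of _ 0 _ 1] in auto)

lemma P_const_mem_M1: "p \<in> P \<Longrightarrow> [:p:] \<in> M (Suc 0)"
  using gen_mem_M[of p 1 1 0] P_subset_Q1 T.one_mem by simp

text \<open>Any nonzero \<open>q \<in> P\<close> can be pulled out of a multiple of \<open>\<chi>\<close>, because \<open>1 / q\<close> may be moved into the
  cofactor.\<close>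
lemma dvd_mem_M1:
  assumes "\<chi> dvd h"
  shows "h \<in> M (Suc 0)"
proof -
  obtain q where q: "q \<in> P" "q \<noteq> 0" using nonzero by (auto simp: P_def)
  have "\<chi> dvd smult (1 / q) h" using assms by (simp add: dvd_smult)
  then show ?thesis
    using gen_mem_M[OF P_subset_Q1[OF q(1)] dvd_mem_polys_mod, of "smult (1 / q) h" 0] q(2) by simp
qed

lemma monom_mem_S: "monom 1 k \<in> M 0"
  by (intro T_subset_M0 DX_T monom_mem one_mem)

lemma polys_over_P_subset_M1: "f \<in> polys_over P \<Longrightarrow> f \<in> M (Suc 0)"
proof (induction f)
  case 0
  then show ?case by (simp add: M1.ideal_zero)
next
  case (pCons p f)
  have "coeff (pCons p f) 0 \<in> P" "coeff (pCons p f) (Suc i) \<in> P" for i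
    using pCons.prems unfolding polys_over_def by blast+
  then have "p \<in> P" "f \<in> polys_over P" by (simp_all add: polys_over_def)
  moreover have "pCons p f = [:p:] + monom 1 1 * f"
    by (simp add: monom_altdef)
  ultimately show ?case
    using pCons.IH M1.ideal_add M1.ideal_mult[OF monom_mem_S] P_const_mem_M1 by simp
qed

text \<open>The ideal of \<open>M 0\<close> generated by \<open>P\<close> and \<open>X\<close>. Since \<open>X^n\<close> is congruent to an element
  of \<open>P[X]\<close> modulo \<open>\<chi>\<close>, the \<open>n\<close>-th power of each of its elements lies in \<open>M 1\<close>.\<close>
definition N :: "'k poly set" where
  "N = {monom 1 1 * a + u | a u. a \<in> M 0 \<and> u \<in> M (Suc 0)}"

lemma M1_subset_N: "u \<in> M (Suc 0) \<Longrightarrow> u \<in> N"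
  unfolding N_def using S.zero_mem by force

sublocale N: ideal_set "M 0" N
proof
  show "N \<subseteq> M 0"
    unfolding N_def using M1.subset monom_mem_S by (auto intro!: S.add_mem S.mult_mem)
  show "0 \<in> N" using M1_subset_N M1.ideal_zero by blast
next
  fix f g assume "f \<in> N" "g \<in> N"
  then obtain a u b v where "f = monom 1 1 * a + u" "g = monom 1 1 * b + v"
    "a \<in> M 0" "u \<in> M (Suc 0)" "b \<in> M 0" "v \<in> M (Suc 0)" unfolding N_def by blast
  moreover from this have "f - g = monom 1 1 * (a - b) + (u - v)"
    by (simp add: algebra_simps)
  ultimately show "f - g \<in> N"
    unfolding N_def using S.diff_mem M1.ideal_diff by blast
next
  fix f g assume "f \<in> M 0" "g \<in> N"
  then obtain b v where "g = monom 1 1 * b + v" "b \<in> M 0" "v \<in> M (Suc 0)" unfolding N_def by blast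
  moreover from this have "f * g = monom 1 1 * (f * b) + f * v"
    by (simp add: algebra_simps)
  ultimately show "f * g \<in> N"
    unfolding N_def using \<open>f \<in> M 0\<close> S.mult_mem M1.ideal_mult by blast
qed

lemma N_power_mem: "g \<in> N \<Longrightarrow> g ^ (n * (n - 1)) \<in> polys_mod \<chi>"
proof -
  assume "g \<in> N"
  then obtain a u where au: "g = monom 1 1 * a + u" "a \<in> M 0" "u \<in> M (Suc 0)"
    unfolding N_def by blast
  have "monom 1 n \<in> M (Suc 0)"
    using M1.ideal_diff[OF dvd_mem_M1 polys_over_P_subset_M1[OF lower], of \<chi>] by simp
  then have "(monom 1 1 * a) ^ n \<in> M (Suc 0)"
    using au(2) by (simp add: power_mult_distrib monom_power M1.ideal_mult_right S.power_mem)
  moreover have "g ^ n - (monom 1 1 * a) ^ n \<in> M (Suc 0)"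
  proof (rule M1.cong_power)
    show "g - monom 1 1 * a \<in> M (Suc 0)" using au by simp
    show "g \<in> M 0" using \<open>g \<in> N\<close> N.subset by blast
    show "monom 1 1 * a \<in> M 0" by (intro S.mult_mem monom_mem_S au(2))
  qed
  ultimately have gn: "g ^ n \<in> M (Suc 0)"
    by (rule M1.cong_mem[rotated])
  have "(g ^ n) ^ k \<in> M k" for k
  proof (induction k)
    case (Suc k)
    then show ?case using M_mult[OF gn Suc] by simp
  qed (simp add: S.one_mem)
  then show ?thesis using M_subset by (auto simp: power_mult)
qed

lemma const_cong:
  assumes "a \<in> polys_over D"
  shows "a - [:coeff a 0:] \<in> N"
proof (cases a)
  case (pCons a0 a')
  then have "a' \<in> M 0" using assms by (auto intro!: T_subset_M0 DX_T)
  moreover have "a - [:coeff a 0:] = monom 1 1 * a' + 0"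
    by (simp add: pCons monom_altdef)
  ultimately show ?thesis unfolding N_def using M1.ideal_zero by blast
qed

lemma P_const_mem_N: "p \<in> P \<Longrightarrow> [:p:] \<in> N"
  by (intro M1_subset_N P_const_mem_M1)

text \<open>Modulo \<open>N\<close> polynomials over \<open>D\<close> become constants and \<open>t X^n w\<close> vanishes, so \<open>f \<equiv> \<kappa> b\<close> with
  \<open>\<kappa> = - w(0)\<close>, and \<open>f - \<kappa> s(0) \<equiv> \<kappa> \<beta>\<close>. The equation for \<open>b\<close> then yields the one for \<open>f\<close>, after
  replacing the two constants by representatives.\<close>
lemma test_poly_residue:
  assumes w: "w \<in> polys_over D" and e: "e > 0"
  defines "f \<equiv> smult t (monom 1 (n - 1) * w) * (smult t (monom 1 n * w) ^ e - 1)"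
  shows "f \<in> M 0"
    and "\<exists>\<sigma>\<in>R. \<exists>\<tau>\<in>R. f * (f - [:\<sigma>:]) ^ (n - 1) - [:\<tau>:] \<in> N"
proof -
  define y where "y = smult t (monom 1 n * w)"
  define \<kappa> where "\<kappa> = - coeff w 0"
  have \<kappa>: "\<kappa> \<in> D" using w by (simp add: \<kappa>_def polys_over_def uminus_mem)
  have w_S: "w \<in> M 0" and s_S: "s \<in> M 0" and \<kappa>_S: "[:\<kappa>:] \<in> M 0"
    using w s \<kappa> by (auto intro!: T_subset_M0 DX_T)
  have b_eq: "b = \<beta> + s" by (simp add: \<beta>_def)
  have b_S: "b \<in> M 0" unfolding b_eq by (intro S.add_mem beta_mem_S s_S)
  have "y = pCons c s * w + \<chi> * smult t w"
    by (simp add: y_def reduction distrib_right flip: mult_smult_left)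
  moreover have "pCons c s * w \<in> N"
  proof -
    have "pCons c s * w - [:c * coeff w 0:] \<in> N"
      using const_cong[OF DX.mult_mem[OF _ w], of "pCons c s"] s c P.subset
      by (auto simp: coeff_mult)
    moreover have "[:c * coeff w 0:] \<in> N"
      using c w by (intro P_const_mem_N P.ideal_mult_right) (auto simp: polys_over_def)
    ultimately show ?thesis by (rule N.cong_mem)
  qed
  moreover have "\<chi> * smult t w \<in> N"
    by (intro M1_subset_N dvd_mem_M1 dvd_triv_left)
  ultimately have y: "y \<in> N"
    by (simp only: N.ideal_add)
  have f_eq: "f = b * (w * (y ^ e - 1))"
    by (simp add: f_def b_def y_def mult.assoc)
  have y_S: "y \<in> M 0" using y N.subset by blast
  show f_S: "f \<in> M 0"
    unfolding f_eq by (intro S.mult_mem S.diff_mem S.power_mem S.one_mem b_S w_S y_S)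
  have "w * y ^ e \<in> N"
    using y e w_S by (intro N.ideal_mult N.ideal_power)
  then have "w * y ^ e - (w - [:coeff w 0:]) \<in> N"
    using const_cong[OF w] by (rule N.ideal_diff)
  moreover have "w * (y ^ e - 1) - [:\<kappa>:] = w * y ^ e - (w - [:coeff w 0:])"
  proof -
    have "[:\<kappa>:] = - [:coeff w 0:]" by (simp add: \<kappa>_def)
    then show ?thesis by (simp only: right_diff_distrib mult_1_right diff_minus_eq_add diff_diff_eq2) simp
  qed
  ultimately have "w * (y ^ e - 1) - [:\<kappa>:] \<in> N"
    by (simp only:)
  then have "(w * (y ^ e - 1) - [:\<kappa>:]) * b \<in> N"
    using b_S by (rule N.ideal_mult_right)
  then have f_cong: "f - [:\<kappa>:] * b \<in> N"
    by (simp add: f_eq algebra_simps)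
  define s0 where "s0 = coeff s 0"
  have s0: "s0 \<in> D" using s by (simp add: s0_def polys_over_def)
  obtain \<sigma> where \<sigma>: "\<sigma> \<in> R" "\<kappa> * s0 - \<sigma> \<in> P"
    using representative_P[OF mult_mem[OF \<kappa> s0]] by blast
  have \<sigma>_S: "[:\<sigma>:] \<in> M 0" using \<sigma>(1) R_subset by (auto intro!: T_subset_M0 const_mem_T)
  have "(f - [:\<kappa>:] * b) + ([:\<kappa>:] * (s - [:s0:]) + [:\<kappa> * s0 - \<sigma>:]) \<in> N"
    using const_cong[OF s] unfolding s0_def[symmetric]
    by (intro N.ideal_add f_cong N.ideal_mult \<kappa>_S P_const_mem_N \<sigma>(2))
  moreover have "(f - [:\<kappa>:] * b) + ([:\<kappa>:] * (s - [:s0:]) + [:\<kappa> * s0 - \<sigma>:])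
      = (f - [:\<sigma>:]) - [:\<kappa>:] * \<beta>"
  proof -
    have "[:\<kappa> * s0 - \<sigma>:] = [:\<kappa>:] * [:s0:] - [:\<sigma>:]" by simp
    moreover have "(f - k * (\<beta> + s)) + (k * (s - z) + (k * z - u)) = (f - u) - k * \<beta>"
      for k z u :: "'k poly" by (simp add: algebra_simps)
    ultimately show ?thesis by (simp only: b_eq)
  qed
  ultimately have "(f - [:\<sigma>:]) - [:\<kappa>:] * \<beta> \<in> N"
    by (simp only:)
  then have "f * (f - [:\<sigma>:]) ^ (n - 1) - ([:\<kappa>:] * b) * ([:\<kappa>:] * \<beta>) ^ (n - 1) \<in> N"
    using f_cong
    by (intro N.cong_mult N.cong_power f_S S.power_mem S.mult_mem S.diff_mem \<sigma>_S \<kappa>_S beta_mem_S)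
  moreover have "([:\<kappa>:] * b) * ([:\<kappa>:] * \<beta>) ^ (n - 1) - [:\<kappa> ^ n * (t * c ^ (n - 1)):] \<in> N"
  proof -
    have \<kappa>_power: "[:\<kappa>:] * [:\<kappa>:] ^ (n - 1) = [:\<kappa> ^ n:]"
      using n by (cases n) (simp_all add: poly_const_pow mult.commute)
    have "([:\<kappa>:] * b) * ([:\<kappa>:] * \<beta>) ^ (n - 1)
        = ([:\<kappa>:] * [:\<kappa>:] ^ (n - 1)) * (b * \<beta> ^ (n - 1))"
      by (simp only: power_mult_distrib mult_ac)
    also have "\<dots> = [:\<kappa> ^ n:] * (b * \<beta> ^ (n - 1))"
      by (simp only: \<kappa>_power)
    finally have regroup: "([:\<kappa>:] * b) * ([:\<kappa>:] * \<beta>) ^ (n - 1)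
        = [:\<kappa> ^ n:] * (b * \<beta> ^ (n - 1))" .
    have "[:\<kappa> ^ n * (t * c ^ (n - 1)):] = [:\<kappa> ^ n:] * [:t * c ^ (n - 1):]"
      by simp
    then have "([:\<kappa>:] * b) * ([:\<kappa>:] * \<beta>) ^ (n - 1) - [:\<kappa> ^ n * (t * c ^ (n - 1)):]
        = [:\<kappa> ^ n:] * (b * \<beta> ^ (n - 1) - [:t * c ^ (n - 1):])"
      by (simp only: regroup right_diff_distrib)
    then show ?thesis
      using norm_beta by (intro M1_subset_N dvd_mem_M1) (metis dvd_mult)
  qed
  moreover obtain \<tau> where \<tau>: "\<tau> \<in> R" "\<kappa> ^ n * (t * c ^ (n - 1)) - \<tau> \<in> P"
    using representative_P[OF mult_mem[OF power_mem[OF \<kappa>] norm_mem]] by blast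
  moreover have "[:\<kappa> ^ n * (t * c ^ (n - 1)):] - [:\<tau>:] \<in> N"
    using P_const_mem_N[OF \<tau>(2)] by simp
  ultimately show "\<exists>\<sigma>\<in>R. \<exists>\<tau>\<in>R. f * (f - [:\<sigma>:]) ^ (n - 1) - [:\<tau>:] \<in> N"
    using \<sigma>(1) N.cong_trans by blast
qed

end

section \<open>The test polynomial\<close>

context denominator_prime
begin

definition test_poly :: "nat \<Rightarrow> 'k poly \<Rightarrow> 'k poly" where
  "test_poly n w = smult t (monom 1 (n - 1) * w) * (smult t (monom 1 n * w) ^ unit_exponent - 1)"

text \<open>The product runs over all equations that a test polynomial can satisfy modulo the ideal \<open>N\<close> of a
  degenerate modulus. The exponent \<open>n\<close> leads from \<open>N\<close> to \<open>M 1\<close>, the exponent \<open>n - 1\<close> from there to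
  \<open>M (n - 1)\<close>, which has no denominators.\<close>
definition residue_eqn :: "nat \<Rightarrow> 'k poly" where
  "residue_eqn n = (\<Prod>\<sigma>\<in>R. \<Prod>\<tau>\<in>R. [:0, 1:] * [:- \<sigma>, 1:] ^ (n - 1) - [:\<tau>:]) ^ (n * (n - 1))"

lemma residue_eqn_mem: "residue_eqn n \<in> polys_over D"
  unfolding residue_eqn_def using R_subset
  by (intro DX.power_mem DX.prod_mem DX.diff_mem DX.mult_mem)
    (auto simp: uminus_mem one_mem zero_mem)

lemma residue_eqn_monic:
  assumes "n \<ge> 2"
  shows "lead_coeff (residue_eqn n) = 1" "degree (residue_eqn n) > 0"
proof -
  define g where "g \<sigma> \<tau> = [:0, 1:] * [:- \<sigma>, 1:] ^ (n - 1) - [:\<tau>:]" for \<sigma> \<tau> :: 'k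
  have deg_g: "degree (g \<sigma> \<tau>) = n" and lead_g: "lead_coeff (g \<sigma> \<tau>) = 1" for \<sigma> \<tau>
  proof -
    define h where "h = [:0, 1:] * [:- \<sigma>, 1:] ^ (n - 1)"
    have deg_h: "degree h = n"
      using assms by (simp add: h_def degree_mult_eq degree_power_eq del: mult_pCons_left)
    have lead_h: "lead_coeff h = 1"
      unfolding h_def lead_coeff_mult lead_coeff_power by simp
    have g: "g \<sigma> \<tau> = h + [:-\<tau>:]" by (simp add: g_def h_def)
    show "degree (g \<sigma> \<tau>) = n" "lead_coeff (g \<sigma> \<tau>) = 1"
      unfolding g using deg_h lead_h assms by (simp_all add: degree_add_eq_left coeff_pCons split: nat.split)
  qed
  have eqn: "residue_eqn n = (\<Prod>\<sigma>\<in>R. \<Prod>\<tau>\<in>R. g \<sigma> \<tau>) ^ (n * (n - 1))"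
    by (simp add: residue_eqn_def g_def)
  show "lead_coeff (residue_eqn n) = 1"
    unfolding eqn by (simp add: lead_coeff_power lead_coeff_prod lead_g)
  have "g \<sigma> \<tau> \<noteq> 0" for \<sigma> \<tau> using lead_g[of \<sigma> \<tau>] by auto
  moreover have "R \<noteq> {}" using representative_P[OF zero_mem] by auto
  ultimately show "degree (residue_eqn n) > 0"
    unfolding eqn using assms finite_R
    by (simp add: degree_power_eq degree_prod_eq_sum_degree deg_g card_gt_0_iff)
qed

lemma coeff_test_poly:
  "coeff (test_poly n w) (n - 1) = - (t * coeff w 0)" if "n > 0"
proof -
  have "test_poly n w
      = monom 1 (n - 1) * (smult t w * (smult t (monom 1 n * w) ^ unit_exponent - 1))"
    by (simp add: test_poly_def mult.assoc)
  \<comment> \<open>The coefficient is the value at \<open>0\<close> of the cofactor of \<open>X^{n-1}\<close>, and \<open>t X^n w\<close> vanishes there.\<close>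
  then have "coeff (test_poly n w) (n - 1)
      = poly (smult t w * (smult t (monom 1 n * w) ^ unit_exponent - 1)) 0"
    by (simp add: coeff_monom_mult poly_0_coeff_0 del: mult_smult_left mult_smult_right)
  also have "\<dots> = - (t * coeff w 0)"
    using that unit_exponent_pos by (simp add: poly_monom zero_power flip: poly_0_coeff_0)
  finally show ?thesis .
qed

text \<open>The three kinds of moduli: not \<open>X^n\<close> modulo \<open>P\<close>, Eisenstein, and degenerate. In the first two the
  test polynomial itself lies in the ring \<open>D[X] + \<chi> K[X]\<close>.\<close>
lemma residue_eqn_test_poly:
  assumes n: "n \<ge> 2" and w: "w \<in> polys_over D" "coeff w 0 \<notin> P"
    and cofactor: "(\<exists>i<n. coeff \<chi> i \<notin> P) \<Longrightarrow> smult t (monom 1 (n - 1) * w) \<in> polys_mod \<chi>"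
    and \<chi>: "\<chi> \<in> polys_over D" "degree \<chi> = n" "coeff \<chi> n = 1"
  shows "pcompose (residue_eqn n) (test_poly n w) \<in> polys_mod \<chi>"
proof -
  interpret T: subring_set "polys_mod \<chi>" by (rule subring_set_polys_mod)
  have DX_T: "f \<in> polys_mod \<chi>" if "f \<in> polys_over D" for f
    using that polys_over_subset_polys_mod by blast
  have const_T: "[:d:] \<in> polys_mod \<chi>" if "d \<in> D" for d
    using that by (intro DX_T) simp
  have "[:coeff (residue_eqn n) i:] \<in> polys_mod \<chi>" for i
    using residue_eqn_mem[of n] by (intro const_T) (simp add: polys_over_def)
  then have reduce: ?thesis if "test_poly n w \<in> polys_mod \<chi>"
    using pcompose_mem_subring[OF T.subring_set_axioms _ that] by blast
  define b where "b = smult t (monom 1 (n - 1) * w)"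
  define y where "y = smult t (monom 1 n * w)"
  have "(monom 1 n :: 'k poly) = monom 1 1 * monom 1 (n - 1)"
    using n by (simp add: mult_monom)
  then have yb: "y = monom 1 1 * b"
    by (simp add: y_def b_def mult.assoc)
  have test: "test_poly n w = b * (y ^ unit_exponent - 1)"
    by (simp add: test_poly_def b_def y_def)
  show ?thesis
  proof (cases "\<exists>i<n. coeff \<chi> i \<notin> P")
    case True
    then have b: "b \<in> polys_mod \<chi>" using cofactor by (simp add: b_def)
    have "monom 1 1 \<in> polys_mod \<chi>" by (intro DX_T monom_mem one_mem)
    then have "test_poly n w \<in> polys_mod \<chi>"
      unfolding test yb using b by (simp only: T.mult_mem T.diff_mem T.power_mem T.one_mem)
    then show ?thesis by (rule reduce)
  next
    case False
    have lower: "\<chi> - monom 1 n \<in> polys_over P"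
      unfolding polys_over_def
    proof (clarify)
      fix i
      consider "i < n" | "i = n" | "i > n" by linarith
      then show "coeff (\<chi> - monom 1 n) i \<in> P"
        using False \<chi> P.ideal_zero by cases (auto simp: coeff_monom coeff_eq_0)
    qed
    \<comment> \<open>The reduction of \<open>t X^n\<close> modulo \<open>\<chi>\<close>.\<close>
    obtain c s where cs: "smult t (monom 1 n - \<chi>) = pCons c s" by (cases "smult t (monom 1 n - \<chi>)")
    have "monom 1 n - \<chi> \<in> polys_over P"
      using PX.ideal_uminus[OF lower] by simp
    then have "pCons c s \<in> polys_over D"
      using smult_t_mem cs by metis
    then have c: "c \<in> D" and s: "s \<in> polys_over D" by simp_all
    have reduction: "smult t (monom 1 n) = pCons c s + smult t \<chi>"
      by (simp flip: cs add: smult_diff_right)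
    show ?thesis
    proof (cases "c \<in> P")
      case True
      interpret degenerate_modulus D t R n \<chi> c s
        by unfold_locales (use n lower True s reduction in auto)
      define f where "f = test_poly n w"
      have f: "f \<in> M 0" "\<exists>\<sigma>\<in>R. \<exists>\<tau>\<in>R. f * (f - [:\<sigma>:]) ^ (n - 1) - [:\<tau>:] \<in> N"
        using test_poly_residue[OF w(1) unit_exponent_pos] unfolding f_def test_poly_def by auto
      define g where "g \<sigma> \<tau> = f * (f - [:\<sigma>:]) ^ (n - 1) - [:\<tau>:]" for \<sigma> \<tau>
      obtain \<sigma> \<tau> where st: "\<sigma> \<in> R" "\<tau> \<in> R" "g \<sigma> \<tau> \<in> N" using f(2) by (auto simp: g_def)
      have const_S: "[:r:] \<in> M 0" if "r \<in> R" for r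
        using that R_subset by (auto intro!: T_subset_M0 const_T)
      have g_S: "g \<sigma>' \<tau>' \<in> M 0" if "\<sigma>' \<in> R" "\<tau>' \<in> R" for \<sigma>' \<tau>'
        unfolding g_def using that f(1)
        by (intro S.diff_mem S.mult_mem S.power_mem const_S)
      have "(\<Prod>\<sigma>'\<in>R. \<Prod>\<tau>'\<in>R. g \<sigma>' \<tau>') \<in> N"
      proof -
        have "(\<Prod>\<tau>'\<in>R. g \<sigma> \<tau>') \<in> N"
          unfolding prod.remove[OF finite_R st(2)]
          using st g_S by (intro N.ideal_mult_right S.prod_mem) auto
        moreover have "(\<Prod>\<sigma>'\<in>R - {\<sigma>}. \<Prod>\<tau>'\<in>R. g \<sigma>' \<tau>') \<in> M 0"
          using g_S by (intro S.prod_mem) auto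
        moreover have "(\<Prod>\<sigma>'\<in>R. \<Prod>\<tau>'\<in>R. g \<sigma>' \<tau>')
            = (\<Prod>\<tau>'\<in>R. g \<sigma> \<tau>') * (\<Prod>\<sigma>'\<in>R - {\<sigma>}. \<Prod>\<tau>'\<in>R. g \<sigma>' \<tau>')"
          by (rule prod.remove[OF finite_R st(1)])
        ultimately show ?thesis by (simp only: N.ideal_mult_right)
      qed
      then have "(\<Prod>\<sigma>'\<in>R. \<Prod>\<tau>'\<in>R. g \<sigma>' \<tau>') ^ (n * (n - 1)) \<in> polys_mod \<chi>"
        by (rule N_power_mem)
      moreover have "pcompose (residue_eqn n) f
          = (\<Prod>\<sigma>'\<in>R. \<Prod>\<tau>'\<in>R. g \<sigma>' \<tau>') ^ (n * (n - 1))"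
      proof -
        have pow: "pcompose (p ^ k) f = pcompose p f ^ k" for p :: "'k poly" and k
          by (induction k) (simp_all add: pcompose_mult)
        have shift: "[:- r:] + f = f - [:r:]" for r
          using uminus_add_conv_diff[of "[:r:]" f] by simp
        show ?thesis
          unfolding residue_eqn_def pow pcompose_prod pcompose_diff pcompose_mult g_def
          by (simp add: pcompose_pCons shift)
      qed
      ultimately show ?thesis by (simp add: f_def)
    next
      case False
      define e where "e = pCons c s * w"
      have e: "e \<in> polys_over D" unfolding e_def using c s w by (intro DX.mult_mem) auto
      have "coeff e 0 = c * coeff w 0" by (simp add: e_def coeff_mult)
      then have e0: "coeff e 0 \<in> D" "coeff e 0 \<notin> P"
        using P_prime[of c "coeff w 0"] False c w by (auto simp: polys_over_def mult_mem)
      have y_e: "\<chi> dvd y - e"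
        by (simp add: y_def e_def reduction distrib_right dvd_mult2 dvd_smult flip: mult_smult_left)
      have y_T: "y \<in> polys_mod \<chi>" unfolding polys_mod_def using y_e e by blast
      \<comment> \<open>Write \<open>(t X^n w)^e - 1 \<equiv> p + X s'\<close>. Its constant term \<open>p\<close> lies in \<open>P\<close>, because \<open>c w(0)\<close> does
         not.\<close>
      obtain p s' where ps: "e ^ unit_exponent - 1 = pCons p s'"
        by (cases "e ^ unit_exponent - 1")
      have "pCons p s' \<in> polys_over D"
        using DX.diff_mem[OF DX.power_mem[OF e] DX.one_mem] by (simp flip: ps)
      then have s': "s' \<in> polys_over D" by simp
      have "p = poly (e ^ unit_exponent - 1) 0" by (simp add: ps)
      then have "p = coeff e 0 ^ unit_exponent - 1" by (simp flip: poly_0_coeff_0)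
      then have p: "p \<in> P" using power_unit_exponent[OF e0] by simp
      have "\<chi> dvd y ^ unit_exponent - e ^ unit_exponent"
        using y_e by (rule dvd_diff_power)
      then obtain k where "y ^ unit_exponent - e ^ unit_exponent = \<chi> * k" by blast
      then have "y ^ unit_exponent - 1 = pCons p s' + \<chi> * k"
        by (simp add: algebra_simps flip: ps)
      then have "test_poly n w = b * pCons p s' + \<chi> * (k * b)"
        by (simp add: test algebra_simps)
      also have "b * pCons p s' = smult p b + s' * y"
        by (simp add: yb monom_altdef mult.commute)
      also have "smult p b = smult (t * p) (monom 1 (n - 1) * w)"
        by (simp add: b_def mult.commute)
      finally have "test_poly n w = smult (t * p) (monom 1 (n - 1) * w) + s' * y + \<chi> * (k * b)" .
      moreover have "smult (t * p) (monom 1 (n - 1) * w) \<in> polys_over D"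
      proof -
        have "[:t * p:] * (monom 1 (n - 1) * w) \<in> polys_over D"
          using p w by (intro DX.mult_mem monom_mem one_mem) (auto simp: P_def)
        then show ?thesis by simp
      qed
      ultimately show ?thesis
        using reduce DX_T s' y_T dvd_mem_polys_mod[of \<chi> "\<chi> * (k * b)"]
        by (simp add: T.add_mem T.mult_mem)
    qed
  qed
qed

end

theorem corollary3p4:
  fixes D :: "'k::field set" and n :: nat
  assumes "dedekind_domain D"
    and "\<not> field (subring_of D)"
    and "finite_residue_fields D"
    and "fraction_field D = UNIV"
    and "n \<ge> 2"
  shows "\<not> integrally_closed (to_fract ` Int_matrices n D :: 'k poly fract set)"
proof
  assume integrally_closed: "integrally_closed (to_fract ` Int_matrices n D :: 'k poly fract set)"
  have D: "domain (subring_of D)"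
    using assms(1) by (simp add: dedekind_domain_def noetherian_domain_def)
  obtain t R where "denominator_prime D t R"
    using exists_denominator_prime assms by blast
  then interpret denominator_prime D t R .
  obtain w where w: "w \<in> polys_over D" "coeff w 0 \<notin> P"
    and cofactor: "\<And>\<chi>. \<lbrakk>\<chi> \<in> polys_over D; degree \<chi> \<le> n; \<exists>i<n. coeff \<chi> i \<notin> P\<rbrakk>
       \<Longrightarrow> smult t (monom 1 (n - 1) * w) \<in> polys_mod \<chi>"
    using residue_cofactor by blast
  let ?f = "test_poly n w"
  have "pcompose (residue_eqn n) ?f \<in> Int_matrices n D"
    unfolding Int_matrices_def
  proof (intro CollectI ballI)
    fix A assume A: "A \<in> matrices_over n D"
    then have A': "A \<in> carrier_mat n n" "\<And>i j. \<lbrakk>i < n; j < n\<rbrakk> \<Longrightarrow> A $$ (i, j) \<in> D"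
      by (simp_all add: matrices_over_iff[OF D])
    have \<chi>: "char_poly A \<in> polys_over D" "degree (char_poly A) = n" "coeff (char_poly A) n = 1"
      using char_poly_mem_polys_over[OF A'] degree_monic_char_poly[OF A'(1)] by auto
    have "pcompose (residue_eqn n) ?f \<in> polys_mod (char_poly A)"
      using \<chi> cofactor by (intro residue_eqn_test_poly assms(5) w) auto
    then show "poly_mat n (pcompose (residue_eqn n) ?f) A \<in> matrices_over n D"
      unfolding polys_mod_def using poly_mat_mem_of_mod_char_poly[OF D A] by blast
  qed
  then have "integral_over (to_fract ` Int_matrices n D) (to_fract ?f)"
    using integral_over_Int_matrices[OF D subring_set_Int_matrices[OF D]]
      residue_eqn_monic[OF assms(5)] residue_eqn_mem by blast
  moreover have "to_fract ?f \<in> fraction_field (to_fract ` Int_matrices n D)"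
    by (simp add: fraction_field_Int_matrices[OF D assms(4)])
  ultimately have "to_fract ?f \<in> to_fract ` Int_matrices n D"
    using integrally_closed by (auto simp: integrally_closed_def)
  then have "?f \<in> Int_matrices n D" by auto
  then have "coeff ?f (n - 1) \<in> D"
    using coeff_mem_of_Int_matrices[OF D] assms(5) by simp
  then have "t * coeff w 0 \<in> D"
    using coeff_test_poly[of n w] assms(5) uminus_mem by fastforce
  then show False
    using w by (simp add: P_def polys_over_def)
qed

end
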